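(* Let $x=\Gamma g\in X$ and suppose $\xi_g=g\infty$ is irrational, i.e. $\xi_g\notin\mathbb P^1(\mathbb F_q(t))$. Then the return times $\tau_r$ form an infinite sequence. For every $r$, $$\tau_{r+1}=\tau_r+2d_r^{\mathrm{geo}}.$$ After deleting and relabeling finitely many initial continued-fraction digits of $\xi_g$ (and discarding a possible finite initial segment of return times), $$d_r^{\mathrm{geo}}=\deg A_r=:d_r.$$ Writing $B_r=\tau_r$, one therefore has $B_{r+1}=B_r+2d_r$. More precisely, during the ascending half of the $r$-th excursion, $$N=B_r+j,\quad k_N=j,\quad \varepsilon_N=\mathrm{bwd},\quad M_N=B_r\qquad(0\le j\le d_r-1),$$ whereas during the descending half, $$N=B_r+d_r+j,\quad k_N=d_r-j,\quad \varepsilon_N=\mathrm{fwd},\quad M_N=B_r+2j\qquad(0\le j\le d_r-1).$$ At $N=B_{r+1}$ the next backward block begins and $M_N=B_{r+1}$.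
   Context: Let $q$ be a prime power, $F=\mathbb F_q((t^{-1}))$, $\mathcal O=\mathbb F_q[[t^{-1}]]$, $\pi=t^{-1}$, $G=\mathrm{SL}_2(F)$, $\Gamma=\mathrm{SL}_2(\mathbb F_q[t])$, $X=\Gamma\backslash G$. $\mathcal T$ is the Bruhat--Tits tree of $\mathrm{PGL}_2(F)$: vertices are homothety classes $[L]$ of $\mathcal O$-lattices in $F^2$, adjacent if representatives can be chosen with $\pi L\subsetneq L'\subsetneq L$, $L/L'\simeq\mathbb F_q$. Put $\bar a_n=[\mathrm{diag}(t^n,1)]$, $v_0=[\mathcal O^2]$, $v_n=\bar a_nv_0$. The quotient of $\mathcal T$ by $\mathrm{PGL}_2(\mathbb F_q[t])$ is a ray represented by $v_0-v_1-v_2-\cdots$, and $h(v)$ is the $n\ge0$ for which $v$ lies in the $\mathrm{PGL}_2(\mathbb F_q[t])$-orbit of $v_n$. All neighbors of a height-$0$ vertex have height $1$; a vertex of height $k\ge1$ has exactly one neighbor of height $k+1$ and exactly $q$ of height $k-1$. The boundary of $\mathcal T$ is $\mathbb P^1(F)$, $\infty=[1:0]$. For $x=\Gamma g$ put $y_N=g\bar a_Nv_0$ ($N\ge0$), the geodesic ray from $gv_0$ to $\xi_g$; $k_N=k_N(x)=h(y_N)$; $\varepsilon_N=\mathrm{bwd}$ if $h(y_{N+1})=k_N+1$ and $\varepsilon_N=\mathrm{fwd}$ if $h(y_{N+1})=k_N-1$; $M_N=N-k_N$. These do not depend on the lift $g$. Return times: the $N\ge 0$ with $k_N=0$ and $k_{N+1}=1$;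 after discarding a possible finite initial segment, they are listed as $0\le\tau_1<\tau_2<\cdots$. $d_r^{\mathrm{geo}}$ is the maximum of $k_N$ during the excursion from $\tau_r$ to $\tau_{r+1}$. Artin continued fraction: for $\xi\in F\setminus\mathbb F_q(t)$, $\xi=[A_0;A_1,A_2,\ldots]$ where $\xi_0=\xi$, $A_r=\lfloor\xi_r\rfloor\in\mathbb F_q[t]$ (the unique polynomial with $\xi_r-A_r\in t^{-1}\mathcal O$), $\xi_{r+1}=(\xi_r-A_r)^{-1}$; $\deg A_r\ge1$ for $r\ge1$. The digits in the statement are those of $\xi=\xi_g$. *)

theory Defs
  imports
    "HOL-Analysis.Determinants"
    "HOL-Library.Infinite_Set"
    "HOL-Computational_Algebra.Formal_Laurent_Series"
begin

text \<open>
  The finite field \<open>F_q\<close> is an arbitrary type \<open>'k :: {field, finite}\<close>. The field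
  \<open>F = F_q((1/t))\<close> is \<^typ>\<open>'k fls\<close>, whose formal variable \<^const>\<open>fls_X\<close> plays the role of
  the uniformizer \<open>1/t\<close>; thus \<open>t\<close> is \<^const>\<open>fls_X_inv\<close>.
\<close>

definition integer_ring :: "'k::field fls set" where
  "integer_ring = range fps_to_fls"

definition poly_to_fls :: "'k::field poly \<Rightarrow> 'k fls" where
  "poly_to_fls p = poly (map_poly fls_const p) fls_X_inv"

definition rational_functions :: "'k::field fls set" where
  "rational_functions = {poly_to_fls p / poly_to_fls r | p r. r \<noteq> 0}"


subsection \<open>The groups\<close>

definition SL2F :: "('k::field fls ^ 2 ^ 2) set" where
  "SL2F = {g. det g = 1}"

definition Gamma :: "('k::field fls ^ 2 ^ 2) set" where
  "Gamma = {map_matrix poly_to_fls A | A :: 'k poly ^ 2 ^ 2. det A = 1}"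

text \<open>\<open>GL_2\<close> of the polynomial ring; it acts on homothety classes through \<open>PGL_2\<close>.\<close>

definition GL2_poly :: "('k::field fls ^ 2 ^ 2) set" where
  "GL2_poly = {map_matrix poly_to_fls A | A :: 'k poly ^ 2 ^ 2. invertible A}"

definition Gamma_coset :: "'k::field fls ^ 2 ^ 2 \<Rightarrow> ('k fls ^ 2 ^ 2) set" where
  "Gamma_coset g = {\<gamma> ** g | \<gamma>. \<gamma> \<in> Gamma}"


subsection \<open>Vertices of the tree and their heights\<close>

text \<open>
  A vertex is a homothety class of lattices, i.e. a set of subsets of \<open>F\<^sup>2\<close>, on which
  matrices act elementwise. All vertices used here are translates of the class of \<open>O\<^sup>2\<close>.
\<close>

definition homothety_class :: "('k::field fls ^ 2) set \<Rightarrow> ('k fls ^ 2) set set" where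
  "homothety_class L = {(*s) c ` L | c. c \<noteq> 0}"

definition act :: "'k::field fls ^ 2 ^ 2 \<Rightarrow> ('k fls ^ 2) set set \<Rightarrow> ('k fls ^ 2) set set" where
  "act g v = (\<lambda>L. (*v) g ` L) ` v"

definition v0 :: "('k::field fls ^ 2) set set" where
  "v0 = homothety_class {w. \<forall>i. w $ i \<in> integer_ring}"

definition abar :: "nat \<Rightarrow> 'k::field fls ^ 2 ^ 2" where
  "abar n = vector [vector [fls_X_inv ^ n, 0], vector [0, 1]]"

definition height :: "('k::field fls ^ 2) set set \<Rightarrow> nat" where
  "height v = (THE n. \<exists>\<gamma> \<in> GL2_poly. v = act \<gamma> (act (abar n) v0))"


subsection \<open>The geodesic ray attached to a point of the quotient\<close>

definition ray_vertex :: "'k::field fls ^ 2 ^ 2 \<Rightarrow> nat \<Rightarrow> ('k fls ^ 2) set set" where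
  "ray_vertex g N = act g (act (abar N) v0)"

definition kht :: "('k::field fls ^ 2 ^ 2) set \<Rightarrow> nat \<Rightarrow> nat" where
  "kht x N = (THE k. \<forall>g \<in> x. height (ray_vertex g N) = k)"

datatype direction = Bwd | Fwd

text \<open>The last branch is never reached: heights of adjacent vertices differ by one.\<close>

definition eps :: "('k::field fls ^ 2 ^ 2) set \<Rightarrow> nat \<Rightarrow> direction" where
  "eps x N =
     (if kht x (N + 1) = kht x N + 1 then Bwd
      else if kht x (N + 1) + 1 = kht x N then Fwd
      else undefined)"

definition Mpos :: "('k::field fls ^ 2 ^ 2) set \<Rightarrow> nat \<Rightarrow> int" where
  "Mpos x N = int N - int (kht x N)"

definition return_times :: "('k::field fls ^ 2 ^ 2) set \<Rightarrow> nat set" where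
  "return_times x = {N. kht x N = 0 \<and> kht x (N + 1) = 1}"

text \<open>
  The increasing listing of the return times that remain after discarding the first \<open>s\<close>
  ones. It is numbered from 1, so only the values at \<open>r \<ge> 1\<close> are meaningful.
\<close>

definition tau :: "('k::field fls ^ 2 ^ 2) set \<Rightarrow> nat \<Rightarrow> nat \<Rightarrow> nat" where
  "tau x s r = Infinite_Set.enumerate (return_times x) (s + (r - 1))"

definition dgeo :: "('k::field fls ^ 2 ^ 2) set \<Rightarrow> nat \<Rightarrow> nat \<Rightarrow> nat" where
  "dgeo x s r = Max (kht x ` {tau x s r .. tau x s (r + 1)})"


subsection \<open>The boundary\<close>

text \<open>
  The point \<open>[a : b]\<close> of the projective line is the line spanned by \<open>(a, b)\<close>; matrices act
  on lines by taking images.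
\<close>

definition proj_pt :: "'k::field fls \<Rightarrow> 'k fls \<Rightarrow> ('k fls ^ 2) set" where
  "proj_pt a b = vec.span {vector [a, b]}"

definition rational_pts :: "('k::field fls ^ 2) set set" where
  "rational_pts = {proj_pt a b | a b.
     a \<in> rational_functions \<and> b \<in> rational_functions \<and> (a \<noteq> 0 \<or> b \<noteq> 0)}"

definition endpoint :: "'k::field fls ^ 2 ^ 2 \<Rightarrow> ('k fls ^ 2) set" where
  "endpoint g = (*v) g ` proj_pt 1 0"

definition affine_coord :: "('k::field fls ^ 2) set \<Rightarrow> 'k fls" where
  "affine_coord P = (THE z. P = proj_pt z 1)"


subsection \<open>Artin continued fractions\<close>

definition poly_floor :: "'k::field fls \<Rightarrow> 'k poly" where
  "poly_floor z = (THE p. z - poly_to_fls p \<in> (*) fls_X ` integer_ring)"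

fun complete_quotient :: "'k::field fls \<Rightarrow> nat \<Rightarrow> 'k fls" where
  "complete_quotient z 0 = z"
| "complete_quotient z (Suc r) =
     inverse (complete_quotient z r - poly_to_fls (poly_floor (complete_quotient z r)))"

definition cf_digit :: "'k::field fls \<Rightarrow> nat \<Rightarrow> 'k poly" where
  "cf_digit z r = poly_floor (complete_quotient z r)"

end

theory Submission
  imports Defs
begin

text \<open>
  Let \<open>g\<close> have rows \<open>(a, b)\<close> and \<open>(c, d)\<close>, and let \<open>\<xi> = a / c\<close>; here \<open>c \<noteq> 0\<close> because \<open>\<infinity>\<close> is
  rational. The height of a vertex can be read off from the polynomial vectors in its lattices:
  if \<open>L = h O\<^sup>2\<close> and \<open>m\<close> is least such that \<open>t\<^sup>m L\<close> contains a nonzero polynomial vector, then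
  the height of the class of \<open>L\<close> is \<open>- 2 m - deg (det h)\<close> (\<open>height_by_poly_vectors\<close>). Existence
  of a representative \<open>v\<^sub>n\<close> is reduction theory (\<open>column_reduction\<close>), uniqueness holds because
  that number is computed from the lattice alone.

  For \<open>h = g diag(t\<^sup>N, 1)\<close> a polynomial vector \<open>w = (p, r)\<close> lies in \<open>t\<^sup>m L\<close> iff
  \<open>deg (d p - b r) \<le> m + N\<close> and \<open>deg (a r - c p) \<le> m\<close>. Writing \<open>\<alpha>\<close> for the first degree and \<open>- \<beta>\<close>
  for the second, this says that \<open>k\<^sub>N\<close> is the maximum over all \<open>w \<noteq> 0\<close> of the tent functions
  \<open>min (N - 2 \<alpha>) (2 \<beta> - N)\<close> (\<open>tent_envelope_ray\<close>). If two vectors are linearly independent, their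
  determinant is a nonzero polynomial, so it has degree at least \<open>0\<close>, and this forces the
  intervals \<open>[2 \<alpha>, 2 \<beta>]\<close> of the two tents to have disjoint interiors; if the vectors are dependent,
  the tents have the same centre and one lies below the other (\<open>ends_disjoint_or_nested\<close>).
  Hence the graph of \<open>k\<close> is a row of tents standing side by side. As \<open>k\<^sub>N\<close> has the parity
  of \<open>N\<close>, the walk leaves height \<open>0\<close> at once, so that each zero of \<open>k\<close> is a return time, and each
  excursion is exactly one tent, which is twice as long as it is high (\<open>excursion\<close>).
  Irrationality of \<open>\<xi>\<close> means \<open>a r - c p \<noteq> 0\<close>: every tent comes down again, and there are
  infinitely many returns (\<open>zero_after\<close>).

  It remains to recognize the tents far out on the ray. If \<open>p/q\<close> and \<open>p'/q'\<close> are consecutive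
  convergents of \<open>\<xi>\<close>, then \<open>deg (q \<xi> - p) = - deg q'\<close>, so \<open>(p, q)\<close> has
  \<open>\<beta> = deg q' - deg c\<close>, and as soon as \<open>q\<close> is large also \<open>\<alpha> = deg q - deg c\<close>. The tents of
  the convergents are therefore adjacent to each other, and the height \<open>\<beta> - \<alpha>\<close> of such a tent is
  \<open>deg q' - deg q\<close>, the degree of a partial quotient (\<open>convergents_are_tents\<close>). Adjacent tents
  have different centres, which rules out any other tent covering their common endpoint
  (\<open>chain_zero\<close>); so these endpoints are precisely the return times from some point on.
\<close>

(* Entries of vectors and matrices and coefficients of power series share the symbol $;
   below it is reserved for the former. *)
no_notation fps_nth (infixl \<open>$\<close> 75)

section \<open>Degrees and polynomials in the field of Laurent series\<close>

text \<open>
  The degree in \<open>t\<close>, that is, minus the valuation. The junk value at zero is \<open>0\<close>.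
\<close>

definition fdeg :: "'k::field fls \<Rightarrow> int" where
  "fdeg z = - fls_subdegree z"

text \<open>
  Unlike an inequality for \<open>fdeg\<close>, this treats zero as having degree minus infinity.
\<close>

definition deg_le :: "'k::field fls \<Rightarrow> int \<Rightarrow> bool" where
  "deg_le z m \<longleftrightarrow> z = 0 \<or> fdeg z \<le> m"

text \<open>
  Shifting the coefficients of \<open>1\<close> by \<open>m\<close> places gives \<open>t\<^sup>m\<close>, also for negative \<open>m\<close>.
\<close>

definition tpow :: "int \<Rightarrow> 'k::field fls" where
  "tpow m = fls_shift m 1"

lemma tpow_nonzero [simp]: "tpow m \<noteq> 0"
  by (simp add: tpow_def fls_shift_eq0_iff)

lemma tpow_add: "(tpow (m + n) :: 'k::field fls) = tpow m * tpow n"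
  using fls_X_intpow_times_fls_X_intpow[of "-m" "-n", where 'a='k] by (simp add: tpow_def add.commute)

lemma tpow_0 [simp]: "tpow 0 = 1"
  by (simp add: tpow_def)

lemma tpow_inverse [simp]: "tpow m * tpow (- m) = 1" "tpow (- m) * tpow m = 1"
  using tpow_add[of m "-m"] tpow_add[of "-m" m] by simp_all

lemma tpow_nat: "fls_X_inv ^ n = tpow (int n)"
  by (simp add: tpow_def fls_X_inv_power_conv_shift_1)

lemma tpow_mult_nth: "fls_nth (tpow m * z) i = fls_nth z (i + m)"
  using fls_X_intpow_times_conv_shift(1)[of "-m" z] by (simp add: tpow_def)

lemma fdeg_tpow [simp]: "fdeg (tpow m) = m"
  by (simp add: fdeg_def tpow_def)

lemma fdeg_0 [simp]: "fdeg 0 = 0"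
  by (simp add: fdeg_def)

lemma fdeg_1 [simp]: "fdeg 1 = 0"
  by (simp add: fdeg_def)

lemma fdeg_minus [simp]: "fdeg (- z) = fdeg z"
  by (simp add: fdeg_def)

lemma fdeg_mult: "y \<noteq> 0 \<Longrightarrow> z \<noteq> 0 \<Longrightarrow> fdeg (y * z) = fdeg y + fdeg z"
  by (simp add: fdeg_def)

lemma fdeg_inverse [simp]: "fdeg (inverse z) = - fdeg z"
  by (simp add: fdeg_def)

lemma deg_le_nth: "deg_le z m \<longleftrightarrow> (\<forall>i < - m. fls_nth z i = 0)"
proof
  assume "\<forall>i < - m. fls_nth z i = 0"
  then show "deg_le z m"
    using fls_subdegree_geI[of z "- m"] by (cases "z = 0") (auto simp: deg_le_def fdeg_def)
qed (auto simp: deg_le_def fdeg_def)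

lemma deg_le_0 [simp]: "deg_le 0 m"
  by (simp add: deg_le_def)

lemma deg_le_1 [simp]: "deg_le 1 m \<longleftrightarrow> 0 \<le> m"
  by (simp add: deg_le_def)

lemma deg_le_self: "deg_le z (fdeg z)"
  by (simp add: deg_le_def)

lemma deg_le_mono: "deg_le z m \<Longrightarrow> m \<le> n \<Longrightarrow> deg_le z n"
  by (auto simp: deg_le_def)

lemma deg_le_add: "deg_le y m \<Longrightarrow> deg_le z m \<Longrightarrow> deg_le (y + z) m"
  by (simp add: deg_le_nth)

lemma deg_le_minus [simp]: "deg_le (- z) m \<longleftrightarrow> deg_le z m"
  by (simp add: deg_le_nth)

lemma deg_le_diff: "deg_le y m \<Longrightarrow> deg_le z m \<Longrightarrow> deg_le (y - z) m"
  by (simp add: deg_le_nth)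

lemma deg_le_mult: "deg_le y m \<Longrightarrow> deg_le z n \<Longrightarrow> deg_le (y * z) (m + n)"
  by (cases "y = 0 \<or> z = 0") (auto simp: deg_le_def fdeg_mult)

lemma deg_le_mult_0: "deg_le y 0 \<Longrightarrow> deg_le z 0 \<Longrightarrow> deg_le (y * z) 0"
  using deg_le_mult[of y 0 z 0] by simp

lemma deg_le_tpow_mult: "deg_le (tpow n * z) m \<longleftrightarrow> deg_le z (m - n)"
  by (cases "z = 0") (auto simp: deg_le_def fdeg_mult)

lemma deg_le_mult_iff: "c \<noteq> 0 \<Longrightarrow> deg_le (c * z) m \<longleftrightarrow> deg_le z (m - fdeg c)"
  by (cases "z = 0") (auto simp: deg_le_def fdeg_mult)

lemma fdeg_add_dominant:
  assumes "y \<noteq> 0" "deg_le z m" "m < fdeg y"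
  shows "y + z \<noteq> 0" "fdeg (y + z) = fdeg y"
proof -
  have "y + z \<noteq> 0 \<and> fdeg (y + z) = fdeg y"
  proof (cases "z = 0")
    case False
    then have less: "fls_subdegree y < fls_subdegree z"
      using assms by (auto simp: deg_le_def fdeg_def)
    then have "fls_subdegree (y + z) = fls_subdegree y"
      by (rule fls_subdegree_add_eq1[OF assms(1)])
    moreover have "y + z \<noteq> 0"
      using less by (metis add_eq_0_iff fls_uminus_subdegree less_irrefl)
    ultimately show ?thesis by (simp add: fdeg_def)
  qed (use assms in simp)
  then show "y + z \<noteq> 0" "fdeg (y + z) = fdeg y" by auto
qed

lemma integer_ring_iff: "z \<in> integer_ring \<longleftrightarrow> deg_le z 0"
proof
  assume "z \<in> integer_ring"
  then show "deg_le z 0" by (auto simp: integer_ring_def deg_le_nth)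
next
  assume "deg_le z 0"
  then have "z = fps_to_fls (fls_regpart z)"
    by (intro fls_eqI) (simp add: deg_le_nth)
  then show "z \<in> integer_ring" by (auto simp: integer_ring_def)
qed

lemma X_times_integer_ring_iff:
  fixes z :: "'k::field fls"
  shows "z \<in> (*) fls_X ` integer_ring \<longleftrightarrow> deg_le z (- 1)"
proof -
  have X: "(fls_X :: 'k fls) = tpow (- 1)"
    by (intro fls_eqI) (auto simp: tpow_def)
  have "z = fls_X * (tpow 1 * z)"
    using tpow_inverse(2)[of 1] by (metis X mult.assoc mult_1)
  moreover have "deg_le z (- 1) \<Longrightarrow> tpow 1 * z \<in> integer_ring"
    by (simp add: integer_ring_iff deg_le_tpow_mult)
  ultimately have "deg_le z (- 1) \<Longrightarrow> z \<in> (*) fls_X ` integer_ring"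
    by blast
  then show ?thesis
    by (auto simp: X integer_ring_iff deg_le_tpow_mult)
qed

lemma poly_to_fls_0 [simp]: "poly_to_fls 0 = 0"
  by (simp add: poly_to_fls_def)

lemma poly_to_fls_pCons: "poly_to_fls (pCons a p) = fls_const a + fls_X_inv * poly_to_fls p"
  by (simp add: poly_to_fls_def map_poly_pCons)

lemma poly_to_fls_nth: "fls_nth (poly_to_fls p) i = (if i \<le> 0 then coeff p (nat (- i)) else 0)"
proof (induction p arbitrary: i)
  case (pCons a p)
  have "fls_nth (fls_X_inv * poly_to_fls p) i = fls_nth (poly_to_fls p) (i + 1)"
    using tpow_mult_nth[of 1 "poly_to_fls p" i] tpow_nat[of 1, where 'a='a] by simp
  moreover have "nat (- i) = Suc (nat (- i - 1))" if "i < 0"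
    using that by simp
  ultimately show ?case
    by (auto simp: poly_to_fls_pCons pCons.IH coeff_pCons split: nat.split)
qed simp

lemma poly_to_fls_1 [simp]: "poly_to_fls 1 = 1"
  by (simp add: one_pCons poly_to_fls_pCons)

lemma poly_to_fls_add: "poly_to_fls (p + r) = poly_to_fls p + poly_to_fls r"
  by (intro fls_eqI) (simp add: poly_to_fls_nth)

lemma poly_to_fls_minus: "poly_to_fls (- p) = - poly_to_fls p"
  by (intro fls_eqI) (simp add: poly_to_fls_nth)

lemma poly_to_fls_diff: "poly_to_fls (p - r) = poly_to_fls p - poly_to_fls r"
  by (intro fls_eqI) (simp add: poly_to_fls_nth)

lemma poly_to_fls_smult: "poly_to_fls (smult c p) = fls_const c * poly_to_fls p"
  by (intro fls_eqI) (simp add: poly_to_fls_nth)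

lemma poly_to_fls_mult: "poly_to_fls (p * r) = poly_to_fls p * poly_to_fls r"
proof (induction p)
  case (pCons a p)
  have "poly_to_fls (pCons a p * r) = poly_to_fls (smult a r) + fls_X_inv * poly_to_fls (p * r)"
    by (simp add: mult_pCons_left poly_to_fls_add poly_to_fls_pCons)
  then show ?case
    by (simp add: pCons.IH poly_to_fls_pCons poly_to_fls_smult algebra_simps)
qed simp

lemmas poly_to_fls_hom =
  poly_to_fls_add poly_to_fls_minus poly_to_fls_diff poly_to_fls_mult

lemma poly_to_fls_monom: "poly_to_fls (monom c n) = fls_const c * tpow (int n)"
  by (intro fls_eqI) (auto simp: poly_to_fls_nth tpow_def)

lemma fdeg_poly [simp]: "fdeg (poly_to_fls p) = int (degree p)"
proof (cases "p = 0")
  case False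
  have "fls_subdegree (poly_to_fls p) = - int (degree p)"
    using False by (intro fls_subdegree_eqI) (auto simp: poly_to_fls_nth intro: coeff_eq_0)
  then show ?thesis by (simp add: fdeg_def)
qed simp

lemma poly_to_fls_eq_0_iff [simp]: "poly_to_fls p = 0 \<longleftrightarrow> p = 0"
proof
  assume "poly_to_fls p = 0"
  then have "coeff p n = 0" for n
    using poly_to_fls_nth[of p "- int n"] by simp
  then show "p = 0" by (simp add: poly_eqI)
qed simp

text \<open>
  A polynomial of degree at most \<open>-1\<close> vanishes.
\<close>

lemma poly_floor_unique:
  assumes "deg_le (z - poly_to_fls p) (- 1)"
  shows "poly_floor z = p"
  unfolding poly_floor_def X_times_integer_ring_iff
proof (rule the_equality)
  fix r assume "deg_le (z - poly_to_fls r) (- 1)"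
  with assms have "deg_le (poly_to_fls (r - p)) (- 1)"
    using deg_le_diff[of "z - poly_to_fls p" "- 1" "z - poly_to_fls r"] by (simp add: poly_to_fls_diff)
  then show "r = p"
    unfolding deg_le_def poly_to_fls_eq_0_iff fdeg_poly by simp
qed (rule assms)

text \<open>
  The floor is the polynomial formed by the coefficients of the nonnegative powers of \<open>t\<close>.
\<close>

lemma poly_floor_error: "deg_le (z - poly_to_fls (poly_floor z)) (- 1)"
proof -
  define p where "p = (\<Sum>n\<le>nat (fdeg z). monom (fls_nth z (- int n)) n)"
  have "coeff p n = fls_nth z (- int n)" for n
    by (auto simp: p_def coeff_sum coeff_monom fdeg_def sum.delta)
  then have "deg_le (z - poly_to_fls p) (- 1)"
    by (simp add: deg_le_nth poly_to_fls_nth)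
  then show ?thesis using poly_floor_unique by metis
qed

section \<open>Two by two matrices\<close>

definition vec2 :: "'a::zero \<Rightarrow> 'a \<Rightarrow> 'a ^ 2" where
  "vec2 x y = vector [x, y]"

definition mat2 :: "'a::zero \<Rightarrow> 'a \<Rightarrow> 'a \<Rightarrow> 'a \<Rightarrow> 'a ^ 2 ^ 2" where
  "mat2 a b c d = vector [vector [a, b], vector [c, d]]"

lemma vec2_nth [simp]: "vec2 x y $ 1 = x" "vec2 x y $ 2 = y"
  by (simp_all add: vec2_def)

lemma mat2_nth [simp]:
  "mat2 a b c d $ 1 $ 1 = a" "mat2 a b c d $ 1 $ 2 = b"
  "mat2 a b c d $ 2 $ 1 = c" "mat2 a b c d $ 2 $ 2 = d"
  by (simp_all add: mat2_def)

lemma vec2_eta: "w = vec2 (w $ 1) (w $ 2)"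
  by (simp add: vec_eq_iff forall_2)

lemma mat2_eta: "A = mat2 (A $ 1 $ 1) (A $ 1 $ 2) (A $ 2 $ 1) (A $ 2 $ 2)"
  by (simp add: vec_eq_iff forall_2)

lemma mat2_exhaust: obtains a b c d where "A = mat2 a b c d"
  using mat2_eta by blast

lemma vec2_eq_iff [simp]: "vec2 x y = vec2 x' y' \<longleftrightarrow> x = x' \<and> y = y'"
  by (simp add: vec_eq_iff forall_2)

lemma mat2_eq_iff [simp]:
  "mat2 a b c d = mat2 a' b' c' d' \<longleftrightarrow> a = a' \<and> b = b' \<and> c = c' \<and> d = d'"
  by (auto simp: vec_eq_iff forall_2)

lemma mat2_mult:
  "mat2 a b c d ** mat2 a' b' c' d' =
     mat2 (a * a' + b * c') (a * b' + b * d') (c * a' + d * c') (c * b' + d * d')"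
  by (simp add: vec_eq_iff forall_2 matrix_matrix_mult_def sum_2)

lemma mat2_mult_vec2: "mat2 a b c d *v vec2 x y = vec2 (a * x + b * y) (c * x + d * y)"
  by (simp add: vec_eq_iff forall_2 matrix_vector_mult_def sum_2)

lemma scale_vec2: "c *s vec2 x y = vec2 (c * x) (c * y)"
  by (simp add: vec_eq_iff forall_2)

lemma det_mat2: "det (mat2 a b c d) = a * d - b * (c :: 'a::comm_ring_1)"
  by (simp add: det_2)

lemma mat_1_mat2: "mat 1 = mat2 1 0 0 (1 :: 'a::zero_neq_one)"
  by (simp add: vec_eq_iff forall_2 mat_def)

lemma map_matrix_mat2: "map_matrix f (mat2 a b c d) = mat2 (f a) (f b) (f c) (f d)"
  by (simp add: vec_eq_iff forall_2)

text \<open>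
  If \<open>u\<close> inverts the determinant, then \<open>u\<close> times the adjugate inverts the matrix.
\<close>

lemma invertible_mat2_iff:
  fixes A :: "'a::comm_ring_1 ^ 2 ^ 2"
  shows "invertible A \<longleftrightarrow> det A dvd 1"
proof
  assume "invertible A"
  then obtain B where "A ** B = mat 1" by (auto simp: invertible_def)
  then have "det A * det B = 1" by (metis det_mul det_I)
  then show "det A dvd 1" by (metis dvdI)
next
  assume "det A dvd 1"
  then obtain u where u: "det A * u = 1" by (metis dvdE)
  obtain a b c d where A: "A = mat2 a b c d" by (rule mat2_exhaust)
  have *: "a * (d * u) - b * (c * u) = 1"
    using u by (simp add: A det_mat2 algebra_simps)
  let ?B = "mat2 (d * u) (- (b * u)) (- (c * u)) (a * u)"
  have "A ** ?B = mat 1" "?B ** A = mat 1"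
    using * by (simp_all add: A mat2_mult mat_1_mat2 algebra_simps)
  then show "invertible A" by (auto simp: invertible_def)
qed

section \<open>The arithmetic group\<close>

lemma map_matrix_mult:
  fixes A B :: "'k::field poly ^ 2 ^ 2"
  shows "map_matrix poly_to_fls (A ** B) = map_matrix poly_to_fls A ** map_matrix poly_to_fls B"
  by (simp add: vec_eq_iff forall_2 matrix_matrix_mult_def sum_2 poly_to_fls_hom)

lemma map_matrix_one: "map_matrix poly_to_fls (mat 1 :: 'k::field poly ^ 2 ^ 2) = mat 1"
  by (simp add: mat_1_mat2 map_matrix_mat2)

lemma GL2_polyI: "invertible A \<Longrightarrow> map_matrix poly_to_fls A \<in> GL2_poly"
  by (auto simp: GL2_poly_def)

lemma GL2_poly_mult: "A \<in> GL2_poly \<Longrightarrow> B \<in> GL2_poly \<Longrightarrow> A ** B \<in> GL2_poly"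
  unfolding GL2_poly_def by clarify (metis invertible_mult map_matrix_mult)

lemma GL2_poly_inverse:
  assumes "A \<in> GL2_poly"
  obtains B where "B \<in> GL2_poly" "A ** B = mat 1" "B ** A = mat 1"
proof -
  obtain A0 B0 where "A = map_matrix poly_to_fls A0" "A0 ** B0 = mat 1" "B0 ** A0 = mat 1"
    using assms by (auto simp: GL2_poly_def invertible_def)
  moreover from this have "invertible B0" by (auto simp: invertible_def)
  ultimately show ?thesis
    using that[of "map_matrix poly_to_fls B0"] by (metis GL2_polyI map_matrix_mult map_matrix_one)
qed

lemma Gamma_subset_GL2_poly: "Gamma \<subseteq> GL2_poly"
  by (auto simp: Gamma_def invertible_mat2_iff intro!: GL2_polyI)

lemma one_in_Gamma: "mat 1 \<in> Gamma"
  unfolding Gamma_def using map_matrix_one det_I by (metis (mono_tags, lifting) mem_Collect_eq)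

lemma fdeg_det_GL2_poly:
  assumes "A \<in> GL2_poly"
  shows "det A \<noteq> 0" "fdeg (det A) = 0"
proof -
  obtain A0 where A0: "A = map_matrix poly_to_fls A0" "det A0 dvd 1"
    using assms by (auto simp: GL2_poly_def invertible_mat2_iff)
  have "det A = poly_to_fls (det A0)"
    by (simp add: A0 det_2 poly_to_fls_hom)
  moreover have "det A0 \<noteq> 0" "degree (det A0) = 0"
    using A0(2) by (auto simp: is_unit_poly_iff)
  ultimately show "det A \<noteq> 0" "fdeg (det A) = 0" by simp_all
qed

lemma abar_mat2: "abar n = mat2 (tpow (int n)) 0 0 1"
  by (simp add: abar_def mat2_def tpow_nat)

section \<open>Lattices and the minimal degree of a polynomial vector\<close>

definition int_lattice :: "('k::field fls ^ 2) set" where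
  "int_lattice = {w. \<forall>i. w $ i \<in> integer_ring}"

lemma vec2_in_int_lattice [simp]: "vec2 x y \<in> int_lattice \<longleftrightarrow> deg_le x 0 \<and> deg_le y 0"
  by (simp add: int_lattice_def forall_2 integer_ring_iff)

lemma int_lattice_image:
  fixes A :: "'a::field fls ^ 2 ^ 2"
  shows "(*v) A ` int_lattice = {A *v vec2 x y | x y. deg_le x 0 \<and> deg_le y 0}"
proof -
  have "int_lattice = {vec2 x y | x y. deg_le x 0 \<and> deg_le (y :: 'a fls) 0}"
    by (auto simp: int_lattice_def forall_2 integer_ring_iff) (metis vec2_eta)
  then show ?thesis by (subst \<open>int_lattice = _\<close>) blast
qed

lemma image_matrix_mult: "(*v) A ` (*v) B ` S = (*v) (A ** B) ` S"
  by (simp add: image_image matrix_vector_mul_assoc)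

lemma scale_conv_mat2: "c *s w = mat2 c 0 0 c *v (w :: 'a::comm_ring_1 ^ 2)"
  by (subst (1 2) vec2_eta[of w]) (simp only: scale_vec2 mat2_mult_vec2, simp)

lemma scale_image: "(*s) c ` S = (*v) (mat2 c 0 0 c) ` (S :: ('a::comm_ring_1 ^ 2) set)"
  by (auto simp: scale_conv_mat2)

lemma mat2_scalar_commute: "mat2 c 0 0 c ** A = A ** mat2 c 0 0 (c :: 'a::comm_ring_1)"
  by (rule mat2_exhaust[of A]) (simp add: mat2_mult mult.commute)

text \<open>
  An integral matrix maps the standard lattice into itself, and the inverse of a matrix with unit
  determinant is again integral, by the adjugate formula.
\<close>

lemma unimodular_int_lattice:
  assumes int: "\<And>i j. deg_le (A $ i $ j) 0" and det: "det A \<noteq> 0" "fdeg (det A) = 0"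
  shows "(*v) A ` int_lattice = int_lattice"
proof -
  have sub: "(*v) B ` int_lattice \<subseteq> int_lattice"
    if int': "\<And>i j. deg_le (B $ i $ j) 0" for B :: "'a fls ^ 2 ^ 2"
  proof -
    obtain a b c d where B: "B = mat2 a b c d" by (rule mat2_exhaust)
    have "deg_le a 0" "deg_le b 0" "deg_le c 0" "deg_le d 0"
      using int'[of 1 1] int'[of 1 2] int'[of 2 1] int'[of 2 2] by (simp_all add: B)
    then show ?thesis
      by (auto simp: B int_lattice_image mat2_mult_vec2 intro!: deg_le_add deg_le_mult_0)
  qed
  obtain a b c d where A: "A = mat2 a b c d" by (rule mat2_exhaust)
  define u where "u = inverse (det A)"
  have u: "det A * u = 1" "deg_le u 0" using det by (simp_all add: u_def deg_le_def)
  then have *: "a * (d * u) - b * (c * u) = 1"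
    by (simp add: A det_mat2 algebra_simps)
  let ?B = "mat2 (d * u) (- (b * u)) (- (c * u)) (a * u)"
  have AB: "A ** ?B = mat 1"
    using * by (simp add: A mat2_mult mat_1_mat2 algebra_simps)
  have entries: "deg_le a 0" "deg_le b 0" "deg_le c 0" "deg_le d 0"
    using int[of 1 1] int[of 1 2] int[of 2 1] int[of 2 2] by (simp_all add: A)
  have "deg_le (?B $ i $ j) 0" for i j
    using exhaust_2[of i] exhaust_2[of j] entries u(2) by (auto intro: deg_le_mult_0)
  then have "int_lattice = (*v) A ` (*v) ?B ` int_lattice" "(*v) ?B ` int_lattice \<subseteq> int_lattice"
    using sub by (simp_all add: image_matrix_mult AB)
  then show ?thesis using sub[OF int] by blast
qed

text \<open>
  The columns of \<open>A\<close> lie in the lattice spanned by the columns of \<open>B\<close>, so \<open>A = B C\<close> for an integral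
  matrix \<open>C\<close>, whose determinant has degree at most \<open>0\<close>.
\<close>

lemma lattice_det_le:
  assumes "(*v) A ` int_lattice \<subseteq> (*v) B ` int_lattice" "det B \<noteq> 0"
  shows "deg_le (det A) (fdeg (det B))"
proof -
  obtain a b c d where A: "A = mat2 a b c d" by (rule mat2_exhaust)
  obtain a' b' c' d' where B: "B = mat2 a' b' c' d'" by (rule mat2_exhaust)
  have "A *v vec2 1 0 \<in> (*v) B ` int_lattice" "A *v vec2 0 1 \<in> (*v) B ` int_lattice"
    by (rule subsetD[OF assms(1)], rule imageI, simp)+
  then obtain x y x' y' where xy: "A *v vec2 1 0 = B *v vec2 x y" "A *v vec2 0 1 = B *v vec2 x' y'"
    and int: "deg_le x 0" "deg_le y 0" "deg_le x' 0" "deg_le y' 0"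
    unfolding int_lattice_image by blast
  have "det A = (x * y' - x' * y) * det B"
    using xy by (simp add: A B mat2_mult_vec2 det_mat2 algebra_simps)
  moreover have "deg_le (x * y' - x' * y) 0"
    using int by (intro deg_le_diff deg_le_mult_0)
  ultimately show ?thesis
    using deg_le_mult[OF _ deg_le_self] by fastforce
qed

text \<open>
  In terms of the norm whose unit ball is \<open>L\<close>, this bounds the length of a shortest nonzero
  polynomial vector by \<open>t\<^sup>m\<close>.
\<close>

definition has_poly_vector :: "('k::field fls ^ 2) set \<Rightarrow> int \<Rightarrow> bool" where
  "has_poly_vector L m \<longleftrightarrow>
     (\<exists>p r. (p \<noteq> 0 \<or> r \<noteq> 0) \<and> vec2 (poly_to_fls p) (poly_to_fls r) \<in> (*s) (tpow m) ` L)"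

lemma GL2_poly_mult_vec:
  fixes p r :: "'k::field poly"
  assumes "D \<in> GL2_poly" "p \<noteq> 0 \<or> r \<noteq> 0"
  obtains p' r' where "p' \<noteq> 0 \<or> r' \<noteq> 0"
    "D *v vec2 (poly_to_fls p) (poly_to_fls r) = vec2 (poly_to_fls p') (poly_to_fls r')"
proof -
  obtain D' where D': "D' ** D = mat 1" by (rule GL2_poly_inverse[OF assms(1)]) blast
  obtain D0 where D0: "D = map_matrix poly_to_fls D0" using assms(1) by (auto simp: GL2_poly_def)
  obtain a b c d where "D0 = mat2 a b c d" by (rule mat2_exhaust)
  then have D: "D = mat2 (poly_to_fls a) (poly_to_fls b) (poly_to_fls c) (poly_to_fls d)"
    by (simp add: D0 map_matrix_mat2)
  let ?p = "a * p + b * r" and ?r = "c * p + d * r"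
  have *: "D *v vec2 (poly_to_fls p) (poly_to_fls r) = vec2 (poly_to_fls ?p) (poly_to_fls ?r)"
    by (simp add: D mat2_mult_vec2 poly_to_fls_hom)
  have "?p \<noteq> 0 \<or> ?r \<noteq> 0"
  proof (rule ccontr)
    assume "\<not> ?thesis"
    then have "D' *v (D *v vec2 (poly_to_fls p) (poly_to_fls r)) = D' *v vec2 0 0"
      by (simp only: * de_Morgan_disj not_not poly_to_fls_0)
    then have "vec2 (poly_to_fls p) (poly_to_fls r) = D' *v vec2 0 0"
      by (simp add: matrix_vector_mul_assoc D')
    also have "\<dots> = vec2 0 0" by (rule mat2_exhaust[of D']) (simp add: mat2_mult_vec2)
    finally show False using assms(2) by simp
  qed
  then show ?thesis using that * by blast
qed

text \<open>
  The matrix \<open>A\<close> and its inverse preserve nonzero polynomial vectors, so it suffices to look at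
  the lattice \<open>c diag(t\<^sup>n, 1) O\<^sup>2\<close>, for which the first basis vector is a shortest polynomial
  vector. The degree of the determinant is the same for all bases of a lattice. Both numbers
  together determine \<open>n\<close>.
\<close>

lemma lattice_shape:
  assumes eq: "(*v) h ` int_lattice = (*s) c ` (*v) A ` (*v) (abar n) ` int_lattice"
    and "det h \<noteq> 0" "c \<noteq> 0" "A \<in> GL2_poly"
  shows "fdeg (det h) = 2 * fdeg c + int n"
    and "has_poly_vector ((*v) h ` int_lattice) m \<longleftrightarrow> - fdeg c - int n \<le> m"
proof -
  define C where "C = mat2 c 0 0 c ** A ** abar n"
  have hC: "(*v) h ` int_lattice = (*v) C ` int_lattice"
    by (simp add: eq C_def scale_image image_matrix_mult matrix_mul_assoc)
  have "det C = c * c * det A * tpow (int n)"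
    by (simp add: C_def det_mul det_mat2 abar_mat2)
  then have C: "det C \<noteq> 0" "fdeg (det C) = 2 * fdeg c + int n"
    using assms(3) fdeg_det_GL2_poly[OF assms(4)] by (simp_all add: fdeg_mult)
  have "deg_le (det h) (fdeg (det C))" "deg_le (det C) (fdeg (det h))"
    using lattice_det_le[of h C] lattice_det_le[of C h] hC C assms(2) by auto
  then show "fdeg (det h) = 2 * fdeg c + int n"
    using C assms(2) by (simp add: deg_le_def)
  obtain B where B: "B \<in> GL2_poly" "A ** B = mat 1" "B ** A = mat 1"
    using GL2_poly_inverse[OF assms(4)] .
  show "has_poly_vector ((*v) h ` int_lattice) m \<longleftrightarrow> - fdeg c - int n \<le> m"
  proof
    assume "has_poly_vector ((*v) h ` int_lattice) m"
    then obtain p r where pr: "p \<noteq> 0 \<or> r \<noteq> 0"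
      and "vec2 (poly_to_fls p) (poly_to_fls r) \<in> (*s) (tpow m) ` (*v) C ` int_lattice"
      by (auto simp: has_poly_vector_def hC)
    then obtain x y where w: "vec2 (poly_to_fls p) (poly_to_fls r) = tpow m *s (C *v vec2 x y)"
      and xy: "deg_le x 0" "deg_le y 0"
      by (subst (asm) int_lattice_image) (elim imageE CollectE exE conjE, simp)
    let ?e = "tpow m * c"
    obtain p' r' where pr': "p' \<noteq> 0 \<or> r' \<noteq> 0"
      "B *v vec2 (poly_to_fls p) (poly_to_fls r) = vec2 (poly_to_fls p') (poly_to_fls r')"
      by (rule GL2_poly_mult_vec[OF B(1) pr])
    \<comment> \<open>Scalar matrices are central, so multiplication by \<open>B\<close> removes \<open>A\<close>.\<close>
    have BC: "B ** (mat2 (tpow m) 0 0 (tpow m) ** C) = mat2 ?e 0 0 ?e ** abar n"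
    proof -
      have "B ** (mat2 (tpow m) 0 0 (tpow m) ** C) = B ** (mat2 ?e 0 0 ?e ** A) ** abar n"
        by (simp add: C_def matrix_mul_assoc) (simp add: mat2_mult flip: matrix_mul_assoc[of B])
      also have "\<dots> = (B ** A) ** mat2 ?e 0 0 ?e ** abar n"
        by (simp only: mat2_scalar_commute[of ?e A] matrix_mul_assoc)
      also have "\<dots> = mat2 ?e 0 0 ?e ** abar n"
        by (simp add: B(3))
      finally show ?thesis .
    qed
    have "vec2 (poly_to_fls p') (poly_to_fls r') = (B ** (mat2 (tpow m) 0 0 (tpow m) ** C)) *v vec2 x y"
      using pr'(2) by (simp add: w scale_conv_mat2 matrix_vector_mul_assoc)
    also have "\<dots> = vec2 (?e * tpow (int n) * x) (?e * y)"
      by (simp add: BC abar_mat2 mat2_mult mat2_mult_vec2)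
    finally have "poly_to_fls p' = ?e * tpow (int n) * x" "poly_to_fls r' = ?e * y" by simp_all
    then have "deg_le (poly_to_fls p') (m + fdeg c + int n)" "deg_le (poly_to_fls r') (m + fdeg c)"
      using xy assms(3) by (simp_all add: deg_le_mult_iff fdeg_mult)
    then show "- fdeg c - int n \<le> m"
      using pr' by (auto simp: deg_le_def)
  next
    assume m: "- fdeg c - int n \<le> m"
    let ?x = "inverse (tpow m * c * tpow (int n))"
    have inv: "tpow m * c * tpow (int n) * ?x = 1"
      using assms(3) by (intro right_inverse) simp
    obtain p r where pr: "p \<noteq> 0 \<or> r \<noteq> 0"
      "A *v vec2 (poly_to_fls 1) (poly_to_fls 0) = vec2 (poly_to_fls p) (poly_to_fls r)"
      by (rule GL2_poly_mult_vec[OF assms(4), of 1 0]) auto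
    have "tpow m *s (C *v vec2 ?x 0) = A *v ((mat2 (tpow m * c) 0 0 (tpow m * c) ** abar n) *v vec2 ?x 0)"
    proof -
      have "mat2 (tpow m) 0 0 (tpow m) ** C
          = (mat2 (tpow m) 0 0 (tpow m) ** mat2 c 0 0 c) ** A ** abar n"
        by (simp only: C_def matrix_mul_assoc)
      also have "\<dots> = mat2 (tpow m * c) 0 0 (tpow m * c) ** A ** abar n"
        by (simp add: mat2_mult)
      also have "\<dots> = A ** (mat2 (tpow m * c) 0 0 (tpow m * c) ** abar n)"
        by (simp only: mat2_scalar_commute[of _ A] matrix_mul_assoc)
      finally show ?thesis
        by (simp only: scale_conv_mat2 matrix_vector_mul_assoc)
    qed
    also have "\<dots> = A *v vec2 1 0"
      by (simp add: abar_mat2 mat2_mult mat2_mult_vec2 inv del: inverse_mult_distrib)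
    finally have "vec2 (poly_to_fls p) (poly_to_fls r) = tpow m *s (C *v vec2 ?x 0)"
      using pr(2) by simp
    moreover have "deg_le ?x 0"
      using m assms(3) by (simp add: deg_le_def fdeg_mult)
    ultimately have "vec2 (poly_to_fls p) (poly_to_fls r) \<in> (*s) (tpow m) ` (*v) C ` int_lattice"
      by (metis deg_le_0 image_eqI vec2_in_int_lattice)
    then show "has_poly_vector ((*v) h ` int_lattice) m"
      using pr(1) by (auto simp: has_poly_vector_def hC)
  qed
qed

section \<open>Reduction theory and the height\<close>

lemma deg_le_lower: "deg_le z m \<Longrightarrow> fls_nth z (- m) = 0 \<Longrightarrow> deg_le z (m - 1)"
  unfolding deg_le_nth
proof (intro allI impI)
  fix i assume "\<forall>i < - m. fls_nth z i = 0" "fls_nth z (- m) = 0" "i < - (m - 1)"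
  then show "fls_nth z i = 0" by (cases "i = - m") auto
qed

text \<open>
  Here the coefficients of \<open>t\<^sup>m\<close> and \<open>t\<^sup>n\<close> may vanish, so the degree bounds need not be attained.
\<close>

lemma leading_coeff_mult:
  assumes "deg_le y m" "deg_le z n"
  shows "fls_nth (y * z) (- (m + n)) = fls_nth y (- m) * fls_nth z (- n)"
proof -
  have drop: "fls_nth (u * v) (- (i + j)) = 0"
    if "deg_le u i" "fls_nth u (- i) = 0" "deg_le v j" for u v :: "'a fls" and i j
  proof -
    have "deg_le (u * v) (i - 1 + j)"
      using that by (intro deg_le_mult deg_le_lower)
    then show ?thesis by (simp add: deg_le_nth)
  qed
  consider "fls_nth y (- m) = 0" | "fls_nth z (- n) = 0"
    | "fls_nth y (- m) \<noteq> 0" "fls_nth z (- n) \<noteq> 0" by blast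
  then show ?thesis
  proof cases
    case 1
    then show ?thesis using drop assms by simp
  next
    case 2
    then show ?thesis using drop[of z n y m] assms by (simp add: mult.commute add.commute)
  next
    case 3
    then have "fls_subdegree y = - m" "fls_subdegree z = - n"
      using assms by (auto intro!: fls_subdegree_eqI simp: deg_le_nth)
    then show ?thesis using fls_times_base[of y z] by simp
  qed
qed

text \<open>
  The first column has degree at most \<open>a\<close> and the second one at most \<open>b\<close>.
\<close>

definition column_bounded :: "'k::field fls ^ 2 ^ 2 \<Rightarrow> int \<Rightarrow> int \<Rightarrow> bool" where
  "column_bounded U a b \<longleftrightarrow>
     deg_le (U $ 1 $ 1) a \<and> deg_le (U $ 2 $ 1) a \<and> deg_le (U $ 1 $ 2) b \<and> deg_le (U $ 2 $ 2) b"

lemma column_bounded_mat2: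
  "column_bounded (mat2 p q r s) a b \<longleftrightarrow> deg_le p a \<and> deg_le r a \<and> deg_le q b \<and> deg_le s b"
  by (simp add: column_bounded_def)

lemma column_bounded_det: "column_bounded U a b \<Longrightarrow> deg_le (det U) (a + b)"
  unfolding column_bounded_def det_2
  using deg_le_mult[of "U $ 1 $ 1" a "U $ 2 $ 2" b] deg_le_mult[of "U $ 1 $ 2" b "U $ 2 $ 1" a]
  by (auto intro!: deg_le_diff simp: add.commute)

lemma mat2_in_GL2_poly:
  "(p * s - q * r) dvd 1 \<Longrightarrow> mat2 (poly_to_fls p) (poly_to_fls q) (poly_to_fls r) (poly_to_fls s) \<in> GL2_poly"
  using GL2_polyI[of "mat2 p q r s"] by (simp add: map_matrix_mat2 invertible_mat2_iff det_mat2)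

lemma swap_in_GL2_poly: "mat2 0 1 1 0 \<in> GL2_poly"
  using mat2_in_GL2_poly[of 0 0 1 1] by simp

lemma transvection_in_GL2_poly: "mat2 1 (poly_to_fls f) 0 1 \<in> GL2_poly"
  using mat2_in_GL2_poly[of 1 1 f 0] by simp

lemma fdeg_det_mult_GL2_poly:
  "det U \<noteq> 0 \<Longrightarrow> E \<in> GL2_poly \<Longrightarrow> det (U ** E) \<noteq> 0 \<and> fdeg (det (U ** E)) = fdeg (det U)"
  by (simp add: det_mul fdeg_mult fdeg_det_GL2_poly)

lemma column_swap:
  assumes "column_bounded U a b"
  shows "column_bounded (U ** mat2 0 1 1 0) b a"
  using assms by (cases U rule: mat2_exhaust) (simp add: mat2_mult column_bounded_mat2)

text \<open>
  The coefficient of \<open>t\<^bsup>a+b\<^esup>\<close> in the determinant is the determinant of the two leading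
  coefficient vectors. As it vanishes, either the leading vector of the first column is zero, so that
  \<open>a\<close> can be lowered, or the leading vector of the second column is \<open>l\<close> times that of the first one,
  and subtracting \<open>l t\<^bsup>b-a\<^esup>\<close> times the first column lowers \<open>b\<close>.
\<close>

lemma column_step:
  assumes U: "column_bounded U a b" and "a \<le> b" and lt: "fdeg (det U) < a + b" and "det U \<noteq> 0"
  obtains E a' b' where "E \<in> GL2_poly" "column_bounded (U ** E) a' b'" "a' + b' = a + b - 1"
proof -
  obtain p q r s where Ueq: "U = mat2 p q r s" by (rule mat2_exhaust)
  note bd = U[unfolded Ueq column_bounded_mat2]
  define P Q R S where "P = fls_nth p (- a)" "Q = fls_nth q (- b)" "R = fls_nth r (- a)" "S = fls_nth s (- b)"
  note PQRS = this
  have "fls_nth (p * s - q * r) (- (a + b)) = P * S - Q * R"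
    using leading_coeff_mult[of p a s b] leading_coeff_mult[of r a q b] bd
    by (simp add: PQRS mult.commute)
  moreover have "fls_nth (p * s - q * r) (- (a + b)) = 0"
  proof -
    have "deg_le (p * s - q * r) (a + b - 1)"
      using lt by (simp add: Ueq det_mat2 deg_le_def)
    then have "\<forall>i < - (a + b - 1). fls_nth (p * s - q * r) i = 0"
      by (simp only: deg_le_nth)
    then show ?thesis by (rule allE[of _ "- (a + b)"]) (erule impE, linarith, assumption)
  qed
  ultimately have PS: "P * S = Q * R" by simp
  show ?thesis
  proof (cases "P = 0 \<and> R = 0")
    case True
    then have "column_bounded U (a - 1) b"
      using bd by (auto simp: Ueq column_bounded_mat2 PQRS intro!: deg_le_lower)
    moreover have "mat 1 \<in> GL2_poly"
      using one_in_Gamma Gamma_subset_GL2_poly by blast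
    ultimately show ?thesis by (intro that[of "mat 1" "a - 1" b]) simp_all
  next
    case False
    \<comment> \<open>At least one of \<open>P\<close> and \<open>R\<close> can be divided by; if \<open>P = 0\<close>, then \<open>Q = 0\<close> as well.\<close>
    define l where "l = (if P = 0 then S / R else Q / P)"
    have l: "Q = l * P" "S = l * R"
      using False PS by (cases "P = 0"; simp add: l_def eq_divide_eq mult.commute)+
    define f where "f = monom (- l) (nat (b - a))"
    have f: "poly_to_fls f = fls_const (- l) * tpow (b - a)"
      using assms(2) by (simp add: f_def poly_to_fls_monom)
    have bdf: "deg_le (poly_to_fls f) (b - a)"
      using deg_le_mult[of "fls_const (- l)" 0 "tpow (b - a)" "b - a"]
      by (simp add: f deg_le_nth tpow_def)
    have "deg_le (z * poly_to_fls f + y) (b - 1)"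
      if "deg_le z a" "deg_le y b" "fls_nth y (- b) = l * fls_nth z (- a)" for y z
    proof (rule deg_le_lower)
      show "deg_le (z * poly_to_fls f + y) b"
        using deg_le_mult[OF that(1) bdf] that(2) by (intro deg_le_add) auto
      have "fls_nth (z * poly_to_fls f) (- (a + (b - a))) = - l * fls_nth z (- a)"
        by (subst leading_coeff_mult[OF that(1) bdf]) (simp add: f tpow_def)
      then show "fls_nth (z * poly_to_fls f + y) (- b) = 0"
        using that(3) by simp
    qed
    then have "column_bounded (U ** mat2 1 (poly_to_fls f) 0 1) a (b - 1)"
      using bd l by (simp add: Ueq mat2_mult column_bounded_mat2 PQRS)
    then show ?thesis by (intro that[OF transvection_in_GL2_poly]) auto
  qed
qed

text \<open>
  Each step lowers the sum of the two bounds by one, but this sum can never fall below the degree of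
  the determinant. Once they agree, the columns are orthogonal in the ultrametric sense.
\<close>

lemma column_reduction:
  assumes "det U \<noteq> 0" "column_bounded U a b"
  shows "\<exists>E a' b'. E \<in> GL2_poly \<and> column_bounded (U ** E) a' b' \<and> a' \<le> b' \<and> a' + b' = fdeg (det U)"
  using assms
proof (induction "nat (a + b - fdeg (det U))" arbitrary: U a b rule: less_induct)
  case less
  have GL1: "mat 1 \<in> GL2_poly" using one_in_Gamma Gamma_subset_GL2_poly by blast
  obtain E0 a0 b0 where E0: "E0 \<in> GL2_poly" "column_bounded (U ** E0) a0 b0" "a0 \<le> b0" "a0 + b0 = a + b"
  proof (cases "a \<le> b")
    case True
    then show ?thesis using that[of "mat 1" a b] GL1 less.prems by simp
  next
    case False
    then show ?thesis
      using that[OF swap_in_GL2_poly column_swap[OF less.prems(2)]] by simp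
  qed
  define V where "V = U ** E0"
  have V: "det V \<noteq> 0" "fdeg (det V) = fdeg (det U)"
    using fdeg_det_mult_GL2_poly[OF less.prems(1) E0(1)] by (auto simp: V_def)
  have le: "fdeg (det U) \<le> a0 + b0"
    using column_bounded_det[OF E0(2)] V by (simp add: V_def deg_le_def)
  show ?case
  proof (cases "fdeg (det U) = a0 + b0")
    case True
    then show ?thesis using E0 by metis
  next
    case False
    then have "fdeg (det V) < a0 + b0" using le V by simp
    then obtain E1 a1 b1 where E1: "E1 \<in> GL2_poly" "column_bounded (V ** E1) a1 b1" "a1 + b1 = a0 + b0 - 1"
      using column_step[of V a0 b0] E0 V by (metis V_def)
    have W: "det (V ** E1) \<noteq> 0" "fdeg (det (V ** E1)) = fdeg (det U)"
      using fdeg_det_mult_GL2_poly[OF V(1) E1(1)] V(2) by auto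
    have "nat (a1 + b1 - fdeg (det (V ** E1))) < nat (a + b - fdeg (det U))"
      using False le E1(3) E0(4) W by simp
    then obtain E2 a2 b2 where "E2 \<in> GL2_poly" "column_bounded (V ** E1 ** E2) a2 b2" "a2 \<le> b2"
      "a2 + b2 = fdeg (det U)"
      using less.hyps[OF _ W(1) E1(2)] W(2) by metis
    moreover have "V ** E1 ** E2 = U ** (E0 ** E1 ** E2)"
      by (simp add: V_def matrix_mul_assoc)
    ultimately show ?thesis
      using E0(1) E1(1) by (metis GL2_poly_mult)
  qed
qed

text \<open>
  Apply the column reduction to the inverse \<open>U\<close> of \<open>h\<close>. When the columns of the result \<open>U A\<close> are
  scaled to degree \<open>0\<close>, one obtains an integral matrix whose determinant is a unit. Hence
  \<open>h O\<^sup>2 = A diag(t\<^bsup>-a\<^esup>, t\<^bsup>-b\<^esup>) O\<^sup>2\<close>, and this lattice is homothetic to \<open>A diag(t\<^bsup>b-a\<^esup>, 1) O\<^sup>2\<close>.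
\<close>

lemma lattice_normal_form:
  fixes h :: "'k::field fls ^ 2 ^ 2"
  assumes "det h \<noteq> 0"
  obtains A n c where "A \<in> GL2_poly" "c \<noteq> 0"
    "(*v) h ` int_lattice = (*s) c ` (*v) A ` (*v) (abar n) ` int_lattice"
proof -
  have "invertible h" using assms by (simp add: invertible_det_nz)
  then obtain U where hU: "h ** U = mat 1" "U ** h = mat 1" by (auto simp: invertible_def)
  then have "det h * det U = 1" by (simp flip: det_mul)
  then have detU: "det U \<noteq> 0" by auto
  \<comment> \<open>Any common bound for the entries can serve to start the reduction.\<close>
  define a where "a = Max {fdeg (U $ i $ j) | i j. True}"
  have fin: "finite {fdeg (U $ i $ j) | i j. True}"
    using finite_image_set2[of "\<lambda>_. True" "\<lambda>_. True" "\<lambda>i j. fdeg (U $ i $ j)"] by simp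
  have "deg_le (U $ i $ j) a" for i j
    unfolding a_def by (rule deg_le_mono[OF deg_le_self Max_ge[OF fin]]) blast
  then have "column_bounded U a a" by (simp add: column_bounded_def)
  from column_reduction[OF detU this] obtain A a b where A: "A \<in> GL2_poly"
    "column_bounded (U ** A) a b" "a \<le> b" "a + b = fdeg (det U)" by blast
  define n where "n = nat (b - a)"
  define D :: "'k fls ^ 2 ^ 2" where "D = mat2 (tpow (- a)) 0 0 (tpow (- b))"
  define K where "K = U ** A ** D"
  have D: "D = mat2 (tpow (- b)) 0 0 (tpow (- b)) ** abar n"
  proof -
    have "tpow (- b) * tpow (b - a) = (tpow (- a) :: 'k fls)"
      by (simp flip: tpow_add)
    then show ?thesis using A(3) by (simp add: D_def n_def abar_mat2 mat2_mult)
  qed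
  have "det D \<noteq> 0" "fdeg (det D) = - (a + b)"
    by (simp_all add: D_def det_mat2 fdeg_mult)
  moreover have "det (U ** A) \<noteq> 0" "fdeg (det (U ** A)) = a + b"
    using fdeg_det_mult_GL2_poly[OF detU A(1)] A(4) by auto
  ultimately have detK: "det K \<noteq> 0" "fdeg (det K) = 0"
    by (simp_all add: K_def det_mul[of "U ** A"] fdeg_mult)
  have "deg_le (K $ i $ j) 0" for i j
  proof -
    obtain p q r s where UA: "U ** A = mat2 p q r s" by (rule mat2_exhaust)
    have K: "K = mat2 (tpow (- a) * p) (tpow (- b) * q) (tpow (- a) * r) (tpow (- b) * s)"
      by (simp add: K_def UA D_def mat2_mult mult.commute)
    show ?thesis
      using exhaust_2[of i] exhaust_2[of j] A(2) unfolding K UA column_bounded_mat2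
      by (auto simp: deg_le_tpow_mult)
  qed
  then have K: "(*v) K ` int_lattice = int_lattice"
    using detK by (rule unimodular_int_lattice)
  have "h ** K = A ** D"
    by (simp add: K_def matrix_mul_assoc hU)
  then have "(*v) (A ** D) ` int_lattice = (*v) h ` (*v) K ` int_lattice"
    by (simp only: image_matrix_mult)
  then have "(*v) h ` int_lattice = (*v) (A ** D) ` int_lattice"
    by (simp only: K)
  also have "A ** D = mat2 (tpow (- b)) 0 0 (tpow (- b)) ** A ** abar n"
    by (simp only: D matrix_mul_assoc mat2_scalar_commute[of _ A])
  finally have "(*v) h ` int_lattice = (*s) (tpow (- b)) ` (*v) A ` (*v) (abar n) ` int_lattice"
    by (simp add: scale_image image_matrix_mult matrix_mul_assoc)
  then show ?thesis using that[OF A(1)] tpow_nonzero by blast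
qed

lemma homothety_class_conv_image: "homothety_class L = (\<lambda>c. (*s) c ` L) ` {c. c \<noteq> 0}"
  by (auto simp: homothety_class_def)

lemma homothety_class_image: "act h (homothety_class L) = homothety_class ((*v) h ` L)"
  for h :: "'k::field fls ^ 2 ^ 2"
proof -
  have "(*v) h ` (*s) c ` L = (*s) c ` (*v) h ` L" for c
    by (simp add: scale_image image_matrix_mult mat2_scalar_commute[of c h])
  then show ?thesis
    unfolding act_def homothety_class_conv_image
    by (subst image_image) (simp only:)
qed

lemma homothety_class_eq_iff:
  fixes L L' :: "('k::field fls ^ 2) set"
  shows "homothety_class L = homothety_class L' \<longleftrightarrow> (\<exists>c. c \<noteq> 0 \<and> L = (*s) c ` L')"
proof
  assume eq: "homothety_class L = homothety_class L'"
  have "L \<in> homothety_class L"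
    unfolding homothety_class_conv_image by (rule image_eqI[of _ _ 1]) simp_all
  then show "\<exists>c. c \<noteq> 0 \<and> L = (*s) c ` L'"
    unfolding eq by (auto simp: homothety_class_def)
next
  assume "\<exists>c. c \<noteq> 0 \<and> L = (*s) c ` L'"
  then obtain c where c: "c \<noteq> 0" "L = (*s) c ` L'" by blast
  have "(*s) d ` L = (*s) (d * c) ` L'" for d
    by (simp add: c image_image vector_smult_assoc)
  moreover have "(\<lambda>d. d * c) ` {d. d \<noteq> 0} = {d. d \<noteq> 0}"
  proof (intro equalityI subsetI)
    fix d :: "'k fls" assume "d \<in> {d. d \<noteq> 0}"
    then show "d \<in> (\<lambda>d. d * c) ` {d. d \<noteq> 0}"
      using c(1) by (intro image_eqI[of _ _ "d / c"]) simp_all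
  qed (use c(1) in auto)
  moreover have "(\<lambda>d. (*s) (d * c) ` L') ` {d. d \<noteq> 0} = (\<lambda>d. (*s) d ` L') ` (\<lambda>d. d * c) ` {d. d \<noteq> 0}"
    by (simp only: image_image)
  ultimately show "homothety_class L = homothety_class L'"
    unfolding homothety_class_conv_image by (simp only:)
qed

lemma v0_eq: "v0 = homothety_class int_lattice"
  by (simp add: v0_def int_lattice_def)

lemma act_act: "act A (act B v) = act (A ** B) v" for A B :: "'k::field fls ^ 2 ^ 2"
  by (simp add: act_def image_image matrix_vector_mul_assoc)

lemma act_one: "act (mat 1) v = v" for v :: "('k::field fls ^ 2) set set"
  by (simp add: act_def)

text \<open>
  The normal form shows that the vertex lies in the orbit of some \<open>v\<^sub>n\<close>. The index is unique since
  every such presentation yields the same \<open>m\<close>, by \<open>lattice_shape\<close>.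
\<close>

theorem height_by_poly_vectors:
  fixes h :: "'k::field fls ^ 2 ^ 2"
  assumes "det h \<noteq> 0"
  obtains m where "int (height (act h v0)) = - 2 * m - fdeg (det h)"
    "\<And>j. has_poly_vector ((*v) h ` int_lattice) j \<longleftrightarrow> m \<le> j"
proof -
  have eq_iff: "act h v0 = act A (act (abar n) v0) \<longleftrightarrow>
    (\<exists>c. c \<noteq> 0 \<and> (*v) h ` int_lattice = (*s) c ` (*v) A ` (*v) (abar n) ` int_lattice)" for A n
    by (simp add: v0_eq homothety_class_image homothety_class_eq_iff)
  obtain A n c where A: "A \<in> GL2_poly" "c \<noteq> 0"
    "(*v) h ` int_lattice = (*s) c ` (*v) A ` (*v) (abar n) ` int_lattice"
    by (rule lattice_normal_form[OF assms])
  define m where "m = - fdeg c - int n"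
  have shape: "fdeg (det h) = 2 * fdeg c + int n"
    "has_poly_vector ((*v) h ` int_lattice) j \<longleftrightarrow> m \<le> j" for j
    using lattice_shape[OF A(3) assms A(2) A(1)] by (auto simp: m_def)
  have "height (act h v0) = n"
    unfolding height_def
  proof (rule the_equality)
    show "\<exists>\<gamma>\<in>GL2_poly. act h v0 = act \<gamma> (act (abar n) v0)"
      using A by (intro bexI[OF _ A(1)], subst eq_iff) (intro exI[of _ c] conjI)
  next
    fix n' assume "\<exists>\<gamma>\<in>GL2_poly. act h v0 = act \<gamma> (act (abar n') v0)"
    then obtain A' where "A' \<in> GL2_poly" "act h v0 = act A' (act (abar n') v0)" ..
    then obtain c' where A': "A' \<in> GL2_poly" "c' \<noteq> 0"
      "(*v) h ` int_lattice = (*s) c' ` (*v) A' ` (*v) (abar n') ` int_lattice"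
      by (subst (asm) eq_iff) (elim exE conjE)
    note shape' = lattice_shape[OF A'(3) assms A'(2) A'(1)]
    have "m = - fdeg c' - int n'"
      using shape(2)[of m] shape'(2)[of m] shape(2)[of "- fdeg c' - int n'"]
        shape'(2)[of "- fdeg c' - int n'"] by linarith
    then show "n' = n" using shape(1) shape'(1) by (simp add: m_def)
  qed
  then have "int (height (act h v0)) = - 2 * m - fdeg (det h)"
    using shape(1) by (simp add: m_def)
  then show ?thesis using shape(2) by (rule that)
qed

lemma height_invariant:
  assumes "A \<in> GL2_poly"
  shows "height (act A v) = height v"
proof -
  obtain B where B: "B \<in> GL2_poly" "B ** A = mat 1" by (rule GL2_poly_inverse[OF assms]) blast
  have "(\<exists>\<gamma>\<in>GL2_poly. act A v = act \<gamma> w) \<longleftrightarrow> (\<exists>\<gamma>\<in>GL2_poly. v = act \<gamma> w)" for w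
  proof
    assume "\<exists>\<gamma>\<in>GL2_poly. act A v = act \<gamma> w"
    then obtain \<gamma> where "\<gamma> \<in> GL2_poly" "act B (act A v) = act B (act \<gamma> w)" by auto
    then show "\<exists>\<gamma>\<in>GL2_poly. v = act \<gamma> w"
      by (intro bexI[OF _ GL2_poly_mult[OF B(1)]]) (simp_all add: act_act act_one B(2))
  next
    assume "\<exists>\<gamma>\<in>GL2_poly. v = act \<gamma> w"
    then obtain \<gamma> where "\<gamma> \<in> GL2_poly" "v = act \<gamma> w" ..
    then show "\<exists>\<gamma>\<in>GL2_poly. act A v = act \<gamma> w"
      by (intro bexI[OF _ GL2_poly_mult[OF assms]]) (simp_all add: act_act)
  qed
  then show ?thesis by (simp add: height_def)
qed

section \<open>Upper envelopes of tents\<close>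

text \<open>
  For \<open>a \<le> b\<close> this is the function of slope \<open>1\<close> and then \<open>-1\<close> that vanishes at \<open>2 a\<close> and at \<open>2 b\<close>; its
  maximum is \<open>b - a\<close>, and it is negative outside of the interval \<open>[2 a, 2 b]\<close>.
\<close>

definition tent :: "int \<Rightarrow> int \<Rightarrow> nat \<Rightarrow> int" where
  "tent a b N = min (int N - 2 * a) (2 * b - int N)"

text \<open>
  A function \<open>k\<close> that is the pointwise maximum of tents, where any two tents either stand over
  intervals with disjoint interiors or have the same centre.
\<close>

locale tent_envelope =
  fixes W :: "'w set" and a b :: "'w \<Rightarrow> int" and k :: "nat \<Rightarrow> nat"
  assumes below: "w \<in> W \<Longrightarrow> tent (a w) (b w) N \<le> int (k N)"
    and attained: "\<exists>w\<in>W. tent (a w) (b w) N = int (k N)"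
    and disjoint_or_nested: "w \<in> W \<Longrightarrow> w' \<in> W \<Longrightarrow>
      b w \<le> a w' \<or> b w' \<le> a w \<or> (\<exists>c. a w' = a w + c \<and> b w' = b w - c)"
begin

lemma parity: "even (k N + N)"
proof -
  obtain w where "tent (a w) (b w) N = int (k N)" using attained by blast
  then have "int (k N + N) = 2 * (int N - a w) \<or> int (k N + N) = 2 * b w"
    by (auto simp: tent_def min_def split: if_splits)
  then have "even (int (k N + N))" by (metis dvd_triv_left)
  then show ?thesis by simp
qed

text \<open>
  A tent that touches the envelope somewhere is the highest one with its centre, and where it is
  nonnegative no tent with another centre can be positive.
\<close>

lemma envelope_eq_tent:
  assumes w: "w \<in> W" "tent (a w) (b w) M = int (k M)" and "0 \<le> tent (a w) (b w) N"
  shows "int (k N) = tent (a w) (b w) N"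
proof -
  obtain w' where w': "w' \<in> W" "tent (a w') (b w') N = int (k N)" using attained by blast
  have "tent (a w') (b w') M \<le> tent (a w) (b w) M" using below[OF w'(1)] w(2) by simp
  then have "tent (a w') (b w') N \<le> tent (a w) (b w) N"
    using disjoint_or_nested[OF w(1) w'(1)] assms(3) unfolding tent_def by auto
  then show ?thesis using below[OF w(1), of N] w'(2) by simp
qed

text \<open>
  By parity \<open>k\<close> is positive at \<open>N + 1\<close>. The tent realizing this value is at most \<open>0\<close> at \<open>N\<close>, so it
  starts at \<open>N\<close>, and \<open>k\<close> follows it until it ends.
\<close>

lemma excursion:
  assumes "k N = 0"
  obtains d where "0 < d" "\<And>j. j \<le> d \<Longrightarrow> k (N + j) = j" "\<And>j. j \<le> d \<Longrightarrow> k (N + d + j) = d - j"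
proof -
  obtain w where w: "w \<in> W" "tent (a w) (b w) (N + 1) = int (k (N + 1))" using attained by blast
  have "odd (k (N + 1))" using parity[of N] parity[of "N + 1"] assms by auto
  then have "k (N + 1) \<noteq> 0" by (metis even_zero)
  moreover have "tent (a w) (b w) N \<le> 0" using below[OF w(1), of N] assms by simp
  ultimately have N: "int N = 2 * a w" and b: "a w < b w"
    using w(2) unfolding tent_def by linarith+
  define d where "d = nat (b w - a w)"
  have k: "int (k (N + i)) = min (int i) (2 * int d - int i)" if "i \<le> 2 * d" for i
  proof -
    have "tent (a w) (b w) (N + i) = min (int i) (2 * int d - int i)"
      using N b by (simp add: tent_def d_def)
    then show ?thesis using envelope_eq_tent[OF w] that by simp
  qed
  show ?thesis
  proof (rule that[of d])
    show "0 < d" using b by (simp add: d_def)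
    show "k (N + j) = j" if "j \<le> d" for j using k[of j] that by simp
    show "k (N + d + j) = d - j" if "j \<le> d" for j
      using k[of "d + j"] that by (simp add: add.assoc)
  qed
qed

text \<open>
  Follow a tent that realizes \<open>k\<close> at \<open>N\<close> down to its right end.
\<close>

lemma zero_after:
  shows "\<exists>N'\<ge>N. k N' = 0"
proof -
  obtain w where w: "w \<in> W" "tent (a w) (b w) N = int (k N)" using attained by blast
  then have "0 \<le> tent (a w) (b w) N" by simp
  then have b: "int N \<le> 2 * b w" "a w \<le> b w" by (auto simp: tent_def)
  then have "tent (a w) (b w) (nat (2 * b w)) = 0" by (simp add: tent_def)
  then show ?thesis using envelope_eq_tent[OF w, of "nat (2 * b w)"] b
    by (intro exI[of _ "nat (2 * b w)"]) simp
qed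

lemma infinite_zeros: "infinite {N. k N = 0}"
  unfolding infinite_nat_iff_unbounded_le using zero_after by auto

lemma enumerate_zeros:
  defines "e \<equiv> enumerate {N. k N = 0}"
  obtains d where "0 < d" "e (Suc n) = e n + 2 * d"
    "\<And>j. j \<le> d \<Longrightarrow> k (e n + j) = j" "\<And>j. j \<le> d \<Longrightarrow> k (e n + d + j) = d - j"
proof -
  have "k (e n) = 0"
    using enumerate_in_set[OF infinite_zeros, of n] by (simp add: e_def)
  then obtain d where d: "0 < d" "\<And>j. j \<le> d \<Longrightarrow> k (e n + j) = j"
    "\<And>j. j \<le> d \<Longrightarrow> k (e n + d + j) = d - j" using excursion by blast
  have "e (Suc n) = (LEAST N. N \<in> {N. k N = 0} \<and> e n < N)"
    unfolding e_def by (rule enumerate_Suc''[OF infinite_zeros])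
  also have "\<dots> = e n + 2 * d"
  proof (rule Least_equality)
    show "e n + 2 * d \<in> {N. k N = 0} \<and> e n < e n + 2 * d"
      using d(1) d(3)[of d] by (simp add: mult_2 add.assoc)
  next
    fix N assume N: "N \<in> {N. k N = 0} \<and> e n < N"
    show "e n + 2 * d \<le> N"
    proof (rule ccontr)
      assume "\<not> ?thesis"
      then have "k N = N - e n \<or> k N = d - (N - e n - d) \<and> N - e n - d < d"
        using d(2)[of "N - e n"] d(3)[of "N - e n - d"] N by (cases "N - e n \<le> d") auto
      then show False using N d(1) by auto
    qed
  qed
  finally show ?thesis using d by (intro that)
qed

lemma zero_followed_by_one: "k N = 0 \<Longrightarrow> k (N + 1) = 1"
  using excursion[of N] by (metis One_nat_def Suc_leI)

lemma Max_excursion: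
  assumes "\<And>j. j \<le> d \<Longrightarrow> k (N + j) = j" "\<And>j. j \<le> d \<Longrightarrow> k (N + d + j) = d - j"
  shows "Max (k ` {N .. N + 2 * d}) = d"
proof (rule Max_eqI)
  fix y assume "y \<in> k ` {N .. N + 2 * d}"
  then obtain M where "N \<le> M" "M \<le> N + 2 * d" "y = k M" by auto
  then obtain i where "i \<le> 2 * d" "y = k (N + i)"
    using that[of "M - N"] by auto
  then show "y \<le> d"
    using assms(1)[of i] assms(2)[of "i - d"] by (cases "i \<le> d") auto
next
  show "d \<in> k ` {N .. N + 2 * d}"
    using assms(1)[of d] by (intro image_eqI[of _ _ "N + d"]) auto
qed simp

text \<open>
  A tent that is positive at the point where the tents of \<open>v\<close> and \<open>w\<close> meet would overlap both of them,
  so it would have the centre of both; but these centres differ.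
\<close>

lemma chain_zero:
  assumes "v \<in> W" "w \<in> W" "b v = a w" "a v < b v" "a w < b w" "0 \<le> a w"
  shows "k (nat (2 * a w)) = 0"
proof (rule ccontr)
  let ?N = "nat (2 * a w)"
  assume "k ?N \<noteq> 0"
  moreover obtain u where u: "u \<in> W" "tent (a u) (b u) ?N = int (k ?N)" using attained by blast
  ultimately have "a u < a w" "a w < b u"
    using assms(6) by (auto simp: tent_def)
  then have "\<exists>c. a u = a w + c \<and> b u = b w - c" "\<exists>c. a u = a v + c \<and> b u = b v - c"
    using disjoint_or_nested[OF assms(2) u(1)] disjoint_or_nested[OF assms(1) u(1)] assms(3-5)
    by auto
  then have "a w + b w = a v + b v" by auto
  then show False using assms(3-5) by simp
qed

lemma chain_positive:
  assumes "w \<in> W" "2 * a w < int N" "int N < 2 * b w"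
  shows "0 < k N"
  using below[OF assms(1), of N] assms(2,3) by (simp add: tent_def)

end

text \<open>
  Some index of the enumeration hits \<open>T 0\<close>, and since \<open>T\<close> skips no element it agrees with the
  enumeration from there on.
\<close>

lemma enumerate_tail:
  fixes S :: "nat set"
  assumes "infinite S" and mem: "\<And>i. T i \<in> S" and less: "\<And>i. T i < T (Suc i)"
    and gap: "\<And>i N. T i < N \<Longrightarrow> N < T (Suc i) \<Longrightarrow> N \<notin> S"
  shows "\<exists>s. \<forall>i. enumerate S (s + i) = T i"
proof -
  obtain s where s: "enumerate S s = T 0" using enumerate_Ex[OF assms(1) mem] by blast
  have "enumerate S (s + i) = T i" for i
  proof (induction i)
    case (Suc i)
    have "enumerate S (Suc (s + i)) = (LEAST N. N \<in> S \<and> T i < N)"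
      using enumerate_Suc''[OF assms(1), of "s + i"] Suc by simp
    also have "\<dots> = T (Suc i)"
      using mem less gap by (intro Least_equality) (auto intro: leI)
    finally show ?case by simp
  qed (use s in simp)
  then show ?thesis by blast
qed

section \<open>The height profile of a ray\<close>

text \<open>
  Up to the factor \<open>t\<^sup>N\<close> in the first one, the upper and the lower form are the coordinates of the
  polynomial vector \<open>w\<close> in the basis of \<open>F\<^sup>2\<close> given by the columns of \<open>g diag(t\<^sup>N, 1)\<close>.
\<close>

definition upper_form :: "'k::field fls ^ 2 ^ 2 \<Rightarrow> 'k poly \<times> 'k poly \<Rightarrow> 'k fls" where
  "upper_form g w = g $ 2 $ 2 * poly_to_fls (fst w) - g $ 1 $ 2 * poly_to_fls (snd w)"

definition lower_form :: "'k::field fls ^ 2 ^ 2 \<Rightarrow> 'k poly \<times> 'k poly \<Rightarrow> 'k fls" where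
  "lower_form g w = g $ 1 $ 1 * poly_to_fls (snd w) - g $ 2 $ 1 * poly_to_fls (fst w)"

text \<open>
  If the upper form vanishes, the tent should be the decreasing function \<open>2 \<beta> - N\<close>, with left
  end at minus infinity. Since only \<open>N \<ge> 0\<close> matters, the value \<open>- \<beta>\<close> for the left end has the same
  effect.
\<close>

definition left_end :: "'k::field fls ^ 2 ^ 2 \<Rightarrow> 'k poly \<times> 'k poly \<Rightarrow> int" where
  "left_end g w = (if upper_form g w = 0 then fdeg (lower_form g w) else fdeg (upper_form g w))"

definition right_end :: "'k::field fls ^ 2 ^ 2 \<Rightarrow> 'k poly \<times> 'k poly \<Rightarrow> int" where
  "right_end g w = - fdeg (lower_form g w)"

lemma SL2F_mat2:
  assumes "g \<in> SL2F"
  obtains a b c d where "g = mat2 a b c d" "a * d - b * c = 1"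
  using assms by (cases g rule: mat2_exhaust) (simp add: SL2F_def det_mat2)

text \<open>
  This is Cramer's rule for a matrix of determinant \<open>1\<close>.
\<close>

lemma forms_recover:
  assumes "g \<in> SL2F"
  shows "g $ 1 $ 1 * upper_form g w + g $ 1 $ 2 * lower_form g w = poly_to_fls (fst w)"
    and "g $ 2 $ 1 * upper_form g w + g $ 2 $ 2 * lower_form g w = poly_to_fls (snd w)"
proof -
  obtain a b c d where g: "g = mat2 a b c d" and det: "a * d - b * c = 1"
    by (rule SL2F_mat2[OF assms])
  let ?p = "poly_to_fls (fst w)" and ?r = "poly_to_fls (snd w)"
  have "g $ 1 $ 1 * upper_form g w + g $ 1 $ 2 * lower_form g w = (a * d - b * c) * ?p"
    "g $ 2 $ 1 * upper_form g w + g $ 2 $ 2 * lower_form g w = (a * d - b * c) * ?r"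
    by (simp_all add: g upper_form_def lower_form_def algebra_simps)
  then show "g $ 1 $ 1 * upper_form g w + g $ 1 $ 2 * lower_form g w = ?p"
    "g $ 2 $ 1 * upper_form g w + g $ 2 $ 2 * lower_form g w = ?r"
    by (simp_all add: det)
qed

lemma forms_cross_product:
  assumes "g \<in> SL2F"
  shows "upper_form g v * lower_form g w - upper_form g w * lower_form g v
    = poly_to_fls (fst v * snd w - fst w * snd v)"
proof -
  obtain a b c d where g: "g = mat2 a b c d" and det: "a * d - b * c = 1"
    by (rule SL2F_mat2[OF assms])
  have "upper_form g v * lower_form g w - upper_form g w * lower_form g v
    = (a * d - b * c) * poly_to_fls (fst v * snd w - fst w * snd v)"
    by (simp add: g upper_form_def lower_form_def poly_to_fls_hom algebra_simps)
  then show ?thesis by (simp add: det)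
qed

lemma has_poly_vector_ray:
  assumes "g \<in> SL2F"
  shows "has_poly_vector ((*v) (g ** abar N) ` int_lattice) m \<longleftrightarrow>
    (\<exists>w. w \<noteq> (0, 0) \<and> deg_le (upper_form g w) (m + int N) \<and> deg_le (lower_form g w) m)"
proof -
  obtain a b c d where g: "g = mat2 a b c d" and det: "a * d - b * c = 1"
    by (rule SL2F_mat2[OF assms])
  have gN: "tpow m *s ((g ** abar N) *v vec2 x y) =
      vec2 (a * (tpow (m + int N) * x) + b * (tpow m * y)) (c * (tpow (m + int N) * x) + d * (tpow m * y))" for x y
    by (simp add: g abar_mat2 mat2_mult mat2_mult_vec2 scale_vec2 tpow_add algebra_simps)
  show ?thesis
  proof
    assume "has_poly_vector ((*v) (g ** abar N) ` int_lattice) m"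
    then obtain p r where pr: "p \<noteq> 0 \<or> r \<noteq> 0"
      and "vec2 (poly_to_fls p) (poly_to_fls r) \<in> (*s) (tpow m) ` (*v) (g ** abar N) ` int_lattice"
      by (auto simp: has_poly_vector_def)
    then obtain x y where w: "vec2 (poly_to_fls p) (poly_to_fls r) = tpow m *s ((g ** abar N) *v vec2 x y)"
      and xy: "deg_le x 0" "deg_le y 0"
      by (subst (asm) int_lattice_image) (elim imageE CollectE exE conjE, simp)
    let ?x = "tpow (m + int N) * x" and ?y = "tpow m * y"
    have p: "poly_to_fls p = a * ?x + b * ?y" and r: "poly_to_fls r = c * ?x + d * ?y"
      using w unfolding gN by simp_all
    have "upper_form g (p, r) = (a * d - b * c) * ?x" "lower_form g (p, r) = (a * d - b * c) * ?y"
      by (simp_all add: upper_form_def lower_form_def g p r) (simp_all add: algebra_simps)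
    then have "upper_form g (p, r) = ?x" "lower_form g (p, r) = ?y" by (simp_all add: det)
    then show "\<exists>w. w \<noteq> (0, 0) \<and> deg_le (upper_form g w) (m + int N) \<and> deg_le (lower_form g w) m"
      using pr xy by (intro exI[of _ "(p, r)"]) (auto simp: deg_le_tpow_mult)
  next
    assume "\<exists>w. w \<noteq> (0, 0) \<and> deg_le (upper_form g w) (m + int N) \<and> deg_le (lower_form g w) m"
    then obtain w where w: "w \<noteq> (0, 0)" "deg_le (upper_form g w) (m + int N)" "deg_le (lower_form g w) m"
      by blast
    let ?x = "tpow (- (m + int N)) * upper_form g w" and ?y = "tpow (- m) * lower_form g w"
    have xy: "tpow (m + int N) * ?x = upper_form g w" "tpow m * ?y = lower_form g w"
      by (simp_all only: mult.assoc[symmetric] tpow_inverse mult_1)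
    have "tpow m *s ((g ** abar N) *v vec2 ?x ?y) = vec2 (poly_to_fls (fst w)) (poly_to_fls (snd w))"
      unfolding gN xy using forms_recover[OF assms, of w] by (simp add: g)
    moreover have "vec2 ?x ?y \<in> int_lattice"
      using w by (simp add: deg_le_tpow_mult add.commute)
    ultimately have "vec2 (poly_to_fls (fst w)) (poly_to_fls (snd w)) \<in>
        (*s) (tpow m) ` (*v) (g ** abar N) ` int_lattice"
      by (metis imageI)
    then show "has_poly_vector ((*v) (g ** abar N) ` int_lattice) m"
      unfolding has_poly_vector_def using w(1)
      by (intro exI[of _ "fst w"] exI[of _ "snd w"]) (auto simp: prod_eq_iff)
  qed
qed

lemma endpoint_conv: "endpoint (mat2 a b c d) = range (\<lambda>k. k *s vec2 a c)"
  by (simp add: endpoint_def proj_pt_def vec.span_singleton image_image scale_vec2 mat2_mult_vec2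
      mult.commute flip: vec2_def)

text \<open>
  If the lower form vanishes at \<open>w\<close>, then \<open>w\<close> is a multiple of the first column of \<open>g\<close>, so the
  endpoint is the line spanned by a polynomial vector.
\<close>

lemma lower_form_nonzero:
  assumes g: "g \<in> SL2F" and irrational: "endpoint g \<notin> rational_pts" and w: "w \<noteq> (0, 0)"
  shows "lower_form g w \<noteq> 0"
proof
  assume zero: "lower_form g w = 0"
  let ?p = "poly_to_fls (fst w)" and ?r = "poly_to_fls (snd w)" and ?u = "upper_form g w"
  obtain a b c d where g_eq: "g = mat2 a b c d" by (rule mat2_exhaust)
  have pr: "a * ?u = ?p" "c * ?u = ?r"
    using forms_recover[OF g, of w] unfolding zero by (simp_all add: g_eq)
  have nz: "?p \<noteq> 0 \<or> ?r \<noteq> 0" using w by (auto simp: prod_eq_iff)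
  then have u: "?u \<noteq> 0" using pr by auto
  have "endpoint g = range (\<lambda>k. k *s vec2 ?p ?r)"
  proof -
    have "range (\<lambda>k. k *s vec2 ?p ?r) = (\<lambda>k. k *s vec2 a c) ` range (\<lambda>k. k * ?u)"
      by (simp add: image_image scale_vec2 mult.commute mult.left_commute flip: pr)
    moreover have "range (\<lambda>k. k * ?u) = UNIV"
      using u by (intro surjI[of _ "\<lambda>k. k / ?u"]) simp
    ultimately show ?thesis by (simp add: g_eq endpoint_conv)
  qed
  then have "endpoint g = proj_pt ?p ?r"
    by (simp add: proj_pt_def vec.span_singleton flip: vec2_def)
  moreover have "poly_to_fls f \<in> rational_functions" for f :: "'a poly"
    unfolding rational_functions_def by (intro CollectI exI[of _ f] exI[of _ 1]) simp
  ultimately have "endpoint g \<in> rational_pts"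
    unfolding rational_pts_def using nz by blast
  then show False using irrational by contradiction
qed

text \<open>
  A nonzero polynomial \<open>U L' - U' L\<close> has nonnegative degree, hence so does one of its two terms;
  this separates the tents. If it vanishes, both forms change by the same factor \<open>L' / L\<close> on passing
  from \<open>v\<close> to \<open>w\<close>, and its degree is the amount by which the tent shrinks.
\<close>

lemma ends_disjoint_or_nested:
  assumes "g \<in> SL2F" "lower_form g v \<noteq> 0" "lower_form g w \<noteq> 0"
  shows "right_end g v \<le> left_end g w \<or> right_end g w \<le> left_end g v
    \<or> (\<exists>c. left_end g w = left_end g v + c \<and> right_end g w = right_end g v - c)"
proof -
  let ?D = "fst v * snd w - fst w * snd v"
  let ?U = "upper_form g v" and ?L = "lower_form g v"
  let ?U' = "upper_form g w" and ?L' = "lower_form g w"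
  have cross: "?U * ?L' - ?U' * ?L = poly_to_fls ?D" by (rule forms_cross_product[OF assms(1)])
  show ?thesis
  proof (cases "?D = 0")
    case False
    have "\<not> deg_le (poly_to_fls ?D) (- 1)" using False by (simp add: deg_le_def)
    then have "\<not> deg_le (?U * ?L') (- 1) \<or> \<not> deg_le (?U' * ?L) (- 1)"
      using deg_le_diff cross by metis
    then show ?thesis
      using assms(2,3) by (auto simp: deg_le_def left_end_def right_end_def fdeg_mult)
  next
    case True
    define c where "c = fdeg ?L' - fdeg ?L"
    have eq: "?U * ?L' = ?U' * ?L" using cross True by simp
    then have "?U = 0 \<longleftrightarrow> ?U' = 0" using assms(2,3) by (metis mult_eq_0_iff)
    moreover have "fdeg ?U + fdeg ?L' = fdeg ?U' + fdeg ?L" if "?U \<noteq> 0" "?U' \<noteq> 0"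
      using arg_cong[OF eq, of fdeg] assms(2,3) that by (simp add: fdeg_mult)
    ultimately have "left_end g w = left_end g v + c" "right_end g w = right_end g v - c"
      by (auto simp: left_end_def right_end_def c_def)
    then show ?thesis by blast
  qed
qed

lemma kht_Gamma_coset: "kht (Gamma_coset g) N = height (act (g ** abar N) v0)"
proof -
  have ray: "height (ray_vertex (A ** g) N) = height (ray_vertex g N)" if "A \<in> Gamma" for A
  proof -
    have "A \<in> GL2_poly" using that Gamma_subset_GL2_poly by blast
    from height_invariant[OF this, of "ray_vertex g N"] show ?thesis
      by (simp add: ray_vertex_def act_act matrix_mul_assoc)
  qed
  have "mat 1 ** g \<in> Gamma_coset g"
    unfolding Gamma_coset_def using one_in_Gamma by blast
  then have mem: "g \<in> Gamma_coset g" by simp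
  have "kht (Gamma_coset g) N = height (ray_vertex g N)"
    unfolding kht_def using mem ray by (intro the_equality) (auto simp: Gamma_coset_def)
  then show ?thesis by (simp add: ray_vertex_def act_act)
qed

text \<open>
  The vector \<open>w\<close> witnesses a polynomial vector in \<open>t\<^sup>j L\<close> exactly for \<open>j\<close> at least
  \<open>max (\<alpha> - N) (- \<beta>)\<close>, and \<open>- N - 2 max (\<alpha> - N) (- \<beta>)\<close> is the value of the tent of \<open>w\<close> at \<open>N\<close>.
\<close>

lemma tent_envelope_ray:
  assumes g: "g \<in> SL2F" and irrational: "endpoint g \<notin> rational_pts"
  shows "tent_envelope (- {(0, 0)}) (left_end g) (right_end g) (kht (Gamma_coset g))"
proof
  note nz = lower_form_nonzero[OF g irrational]
  have detN: "det (g ** abar N) = tpow (int N)" for N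
    using g by (simp add: SL2F_def det_mul abar_mat2 det_mat2)
  have profile: "\<exists>m. int (kht (Gamma_coset g) N) = - 2 * m - int N \<and>
    (\<forall>j. (\<exists>w. w \<noteq> (0, 0) \<and> deg_le (upper_form g w) (j + int N) \<and> deg_le (lower_form g w) j) \<longleftrightarrow> m \<le> j)" for N
  proof -
    obtain m where "int (height (act (g ** abar N) v0)) = - 2 * m - fdeg (det (g ** abar N))"
      "\<And>j. has_poly_vector ((*v) (g ** abar N) ` int_lattice) j \<longleftrightarrow> m \<le> j"
      using height_by_poly_vectors[of "g ** abar N"] by (metis detN tpow_nonzero)
    then show ?thesis
      by (intro exI[of _ m]) (simp add: kht_Gamma_coset detN has_poly_vector_ray[OF g])
  qed
  show "tent (left_end g w) (right_end g w) N \<le> int (kht (Gamma_coset g) N)"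
    if "w \<in> - {(0, 0)}" for w N
  proof -
    obtain m where m: "int (kht (Gamma_coset g) N) = - 2 * m - int N"
      "\<And>j. (\<exists>w. w \<noteq> (0, 0) \<and> deg_le (upper_form g w) (j + int N) \<and> deg_le (lower_form g w) j) \<longleftrightarrow> m \<le> j"
      using profile by blast
    define j where "j = max (left_end g w - int N) (- right_end g w)"
    have "deg_le (upper_form g w) (j + int N)" "deg_le (lower_form g w) j"
      by (auto simp: deg_le_def j_def left_end_def right_end_def)
    then have "m \<le> j" using that by (subst m(2)[symmetric]) blast
    then show ?thesis by (auto simp: m(1) tent_def j_def)
  qed
  note below = this
  show "\<exists>w\<in>- {(0, 0)}. tent (left_end g w) (right_end g w) N = int (kht (Gamma_coset g) N)" for N
  proof -
    obtain m where m: "int (kht (Gamma_coset g) N) = - 2 * m - int N"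
      "\<And>j. (\<exists>w. w \<noteq> (0, 0) \<and> deg_le (upper_form g w) (j + int N) \<and> deg_le (lower_form g w) j) \<longleftrightarrow> m \<le> j"
      using profile by blast
    obtain w where w: "w \<noteq> (0, 0)" "deg_le (upper_form g w) (m + int N)" "deg_le (lower_form g w) m"
      using m(2)[of m] by blast
    then have "left_end g w \<le> m + int N" "- right_end g w \<le> m"
      using nz[OF w(1)] by (auto simp: deg_le_def left_end_def right_end_def)
    then have "int (kht (Gamma_coset g) N) \<le> tent (left_end g w) (right_end g w) N"
      by (simp add: m(1) tent_def)
    then show ?thesis using below[of w N] w(1) by (intro bexI[of _ w]) auto
  qed
  show "right_end g v \<le> left_end g w \<or> right_end g w \<le> left_end g v
    \<or> (\<exists>c. left_end g w = left_end g v + c \<and> right_end g w = right_end g v - c)"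
    if "v \<in> - {(0, 0)}" "w \<in> - {(0, 0)}" for v w
    using that nz by (intro ends_disjoint_or_nested[OF g]) auto
qed

section \<open>Convergents\<close>

text \<open>
  Indices are shifted by one against the usual convention: the pair \<open>(1, 0)\<close> is put in front,
  so that \<open>cf_convergent z (n + 1)\<close> consists of numerator and denominator of \<open>[A\<^sub>0; A\<^sub>1, \<dots>, A\<^sub>n]\<close>.
\<close>

fun cf_convergent :: "'k::field fls \<Rightarrow> nat \<Rightarrow> 'k poly \<times> 'k poly" where
  "cf_convergent z 0 = (1, 0)"
| "cf_convergent z (Suc 0) = (cf_digit z 0, 1)"
| "cf_convergent z (Suc (Suc n)) =
     (cf_digit z (Suc n) * fst (cf_convergent z (Suc n)) + fst (cf_convergent z n),
      cf_digit z (Suc n) * snd (cf_convergent z (Suc n)) + snd (cf_convergent z n))"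

definition approx_error :: "'k::field fls \<Rightarrow> nat \<Rightarrow> 'k fls" where
  "approx_error z n = poly_to_fls (snd (cf_convergent z n)) * z - poly_to_fls (fst (cf_convergent z n))"

text \<open>
  The next complete quotient is the inverse of something of degree at most \<open>-1\<close>, so its degree is
  positive and is not changed by removing the fractional part.
\<close>

lemma complete_quotient_Suc_degree:
  assumes "complete_quotient z n \<noteq> poly_to_fls (cf_digit z n)"
  shows "fdeg (complete_quotient z (Suc n)) = int (degree (cf_digit z (Suc n)))"
    and "1 \<le> degree (cf_digit z (Suc n))"
proof -
  let ?y = "complete_quotient z (Suc n)"
  have "deg_le (complete_quotient z n - poly_to_fls (cf_digit z n)) (- 1)"
    by (simp add: cf_digit_def poly_floor_error)
  then have y: "?y \<noteq> 0" "1 \<le> fdeg ?y"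
    using assms by (auto simp: deg_le_def simp flip: cf_digit_def)
  have err: "deg_le (- (?y - poly_to_fls (cf_digit z (Suc n)))) (- 1)"
    unfolding deg_le_minus cf_digit_def by (rule poly_floor_error)
  have "fdeg (?y + - (?y - poly_to_fls (cf_digit z (Suc n)))) = fdeg ?y"
    by (rule fdeg_add_dominant(2)[OF y(1) err]) (use y(2) in simp)
  then show "fdeg ?y = int (degree (cf_digit z (Suc n)))" by (simp del: complete_quotient.simps)
  then show "1 \<le> degree (cf_digit z (Suc n))" using y(2) by simp
qed

text \<open>
  The recursion for the convergents turns the equation
  \<open>approx_error z (n + 1) * complete_quotient z (n + 1) = - approx_error z n\<close> into the same equation
  for the next index. Irrationality keeps the errors nonzero, so the algorithm never stops.
\<close>

lemma convergent_step:
  assumes irrational: "\<And>p r. r \<noteq> 0 \<Longrightarrow> poly_to_fls r * z \<noteq> poly_to_fls p"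
  shows "snd (cf_convergent z (Suc n)) \<noteq> 0
    \<and> degree (snd (cf_convergent z n)) \<le> degree (snd (cf_convergent z (Suc n)))
    \<and> approx_error z (Suc n) * complete_quotient z (Suc n) = - approx_error z n
    \<and> fdeg (complete_quotient z (Suc n)) = int (degree (cf_digit z (Suc n)))
    \<and> 1 \<le> degree (cf_digit z (Suc n))"
proof (induction n)
  case 0
  have "z \<noteq> poly_to_fls (cf_digit z 0)" using irrational[of 1] by simp
  then show ?case
    using complete_quotient_Suc_degree[of z 0]
    by (simp add: approx_error_def flip: cf_digit_def) (simp add: cf_digit_def)
next
  case (Suc n)
  let ?A = "cf_digit z (Suc n)" and ?x = "complete_quotient z (Suc n)"
  let ?q = "snd (cf_convergent z (Suc n))"
  have "degree (?A * ?q) = degree ?A + degree ?q"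
    using Suc by (intro degree_mult_eq) auto
  then have "degree (snd (cf_convergent z n)) < degree (?A * ?q)" using Suc by simp
  then have "degree (snd (cf_convergent z (Suc (Suc n)))) = degree (?A * ?q)"
    by (simp add: degree_add_eq_left)
  with \<open>degree (?A * ?q) = _\<close> have deg: "degree ?q < degree (snd (cf_convergent z (Suc (Suc n))))"
    using Suc by simp
  then have q: "snd (cf_convergent z (Suc (Suc n))) \<noteq> 0" by auto
  have err: "approx_error z (Suc (Suc n)) = - (approx_error z (Suc n) * (?x - poly_to_fls ?A))"
  proof -
    have "approx_error z (Suc (Suc n)) = poly_to_fls ?A * approx_error z (Suc n) + approx_error z n"
      by (simp add: approx_error_def poly_to_fls_hom algebra_simps)
    also have "approx_error z n = - (approx_error z (Suc n) * ?x)" using Suc by simp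
    finally show ?thesis by (simp add: algebra_simps del: complete_quotient.simps)
  qed
  moreover have "approx_error z (Suc (Suc n)) \<noteq> 0"
    using irrational[OF q] by (simp add: approx_error_def del: cf_convergent.simps)
  ultimately have "?x - poly_to_fls ?A \<noteq> 0" by auto
  moreover have "complete_quotient z (Suc (Suc n)) = inverse (?x - poly_to_fls ?A)"
    by (simp add: cf_digit_def)
  ultimately have "approx_error z (Suc (Suc n)) * complete_quotient z (Suc (Suc n)) = - approx_error z (Suc n)"
    and "?x \<noteq> poly_to_fls ?A"
    by (simp_all add: err del: complete_quotient.simps)
  then show ?case
    using complete_quotient_Suc_degree[of z "Suc n"] q deg by (simp del: complete_quotient.simps cf_convergent.simps)
qed

context
  fixes z :: "'k::field fls"
  assumes irrational: "\<And>p r. r \<noteq> 0 \<Longrightarrow> poly_to_fls r * z \<noteq> poly_to_fls p"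
begin

lemma degree_convergent_Suc_Suc:
  "degree (snd (cf_convergent z (Suc (Suc n)))) =
    degree (snd (cf_convergent z (Suc n))) + degree (cf_digit z (Suc n))"
proof -
  have "degree (cf_digit z (Suc n) * snd (cf_convergent z (Suc n))) =
      degree (cf_digit z (Suc n)) + degree (snd (cf_convergent z (Suc n)))"
    using convergent_step[OF irrational, of n] by (intro degree_mult_eq) auto
  moreover from this have "degree (snd (cf_convergent z n)) < degree (cf_digit z (Suc n) * snd (cf_convergent z (Suc n)))"
    using convergent_step[OF irrational, of n] by simp
  ultimately show ?thesis by (simp add: degree_add_eq_left)
qed

lemma degree_convergent_ge: "n \<le> degree (snd (cf_convergent z (Suc n)))"
proof (induction n)
  case (Suc n)
  then show ?case
    using convergent_step[OF irrational, of n] by (simp add: degree_convergent_Suc_Suc del: cf_convergent.simps)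
qed simp

text \<open>
  With each step the error loses the degree of the complete quotient, which is the degree that
  the denominator gains.
\<close>

lemma fdeg_approx_error:
  "approx_error z n \<noteq> 0 \<and> fdeg (approx_error z n) = - int (degree (snd (cf_convergent z (Suc n))))"
proof (induction n)
  case 0
  then show ?case by (simp add: approx_error_def)
next
  case (Suc n)
  note step = convergent_step[OF irrational, of n]
  have prod: "approx_error z (Suc n) * complete_quotient z (Suc n) \<noteq> 0"
    using step Suc by simp
  then have "fdeg (approx_error z (Suc n)) + fdeg (complete_quotient z (Suc n)) = fdeg (approx_error z n)"
    using step by (metis fdeg_minus fdeg_mult mult_eq_0_iff)
  moreover have "approx_error z (Suc n) \<noteq> 0" using prod by auto
  ultimately show ?case
    using step Suc by (simp add: degree_convergent_Suc_Suc del: cf_convergent.simps complete_quotient.simps)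
qed

end


section \<open>The dictionary between excursions and partial quotients\<close>

lemma affine_coord_endpoint:
  assumes "c \<noteq> 0"
  shows "affine_coord (endpoint (mat2 a b c d)) = a / c"
proof -
  have conv: "proj_pt z 1 = range (\<lambda>k. k *s vec2 z 1)" for z
    by (simp add: proj_pt_def vec.span_singleton flip: vec2_def)
  have "range (\<lambda>k. k *s vec2 a c) = (\<lambda>k. k *s vec2 (a / c) 1) ` range (\<lambda>k. k * c)"
    using assms by (simp add: image_image scale_vec2)
  moreover have "range (\<lambda>k. k * c) = UNIV"
    using assms by (intro surjI[of _ "\<lambda>k. k / c"]) simp
  ultimately have eq: "endpoint (mat2 a b c d) = proj_pt (a / c) 1"
    by (simp add: endpoint_conv conv)
  show ?thesis
    unfolding affine_coord_def
  proof (rule the_equality)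
    show "endpoint (mat2 a b c d) = proj_pt (a / c) 1" by (rule eq)
  next
    fix z assume "endpoint (mat2 a b c d) = proj_pt z 1"
    then have "range (\<lambda>k. k *s vec2 (a / c) 1) = range (\<lambda>k. k *s vec2 z 1)"
      by (simp add: eq conv)
    then have "1 *s vec2 (a / c) 1 \<in> range (\<lambda>k. k *s vec2 z 1)" by blast
    then show "z = a / c" by (auto simp: scale_vec2)
  qed
qed

text \<open>
  The lower form of a convergent is \<open>c\<close> times its approximation error. The upper form is, up to the
  factor \<open>c\<close>, the denominator \<open>q\<close> minus \<open>c d\<close> times this error, and \<open>q\<close> dominates once its degree
  exceeds \<open>deg c + deg d\<close>.
\<close>

lemma convergents_are_tents:
  assumes g: "g \<in> SL2F" and "endpoint g \<notin> rational_pts"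
  defines "z \<equiv> affine_coord (endpoint g)"
  defines "w \<equiv> cf_convergent z"
  shows "\<exists>n0. \<forall>n\<ge>n0. w n \<noteq> (0, 0) \<and> right_end g (w n) = left_end g (w (Suc n))
    \<and> left_end g (w (Suc n)) = left_end g (w n) + int (degree (cf_digit z n))
    \<and> 0 \<le> left_end g (w n) \<and> 1 \<le> degree (cf_digit z n)"
proof -
  obtain a b c d where g_eq: "g = mat2 a b c d" and det: "a * d - b * c = 1"
    by (rule SL2F_mat2[OF g])
  note nz = lower_form_nonzero[OF assms(1,2)]
  have c: "c \<noteq> 0" using nz[of "(1, 0)"] by (simp add: lower_form_def g_eq)
  have z: "z = a / c" using affine_coord_endpoint[OF c] by (simp add: z_def g_eq)
  have irrational: "poly_to_fls r * z \<noteq> poly_to_fls p" if "r \<noteq> 0" for p r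
    using nz[of "(p, r)"] that c by (auto simp: lower_form_def g_eq z field_simps)
  define Q where "Q n = int (degree (snd (w n)))" for n
  have lower: "lower_form g (w n) = c * approx_error z n" for n
    using c by (simp add: lower_form_def g_eq approx_error_def z w_def algebra_simps)
  have err: "approx_error z n \<noteq> 0" "fdeg (approx_error z n) = - Q (Suc n)" for n
    using fdeg_approx_error[OF irrational, of n] by (auto simp: Q_def w_def)
  have right: "right_end g (w n) = Q (Suc n) - fdeg c" for n
    using c err by (simp add: right_end_def lower fdeg_mult)
  have Qge: "int n \<le> Q (Suc n)" for n
    using degree_convergent_ge[OF irrational, of n] by (simp add: Q_def w_def)
  have left: "left_end g (w (Suc n)) = Q (Suc n) - fdeg c" if "\<bar>fdeg d\<bar> + \<bar>fdeg c\<bar> < int n" for n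
  proof -
    let ?q = "poly_to_fls (snd (w (Suc n)))" and ?e = "- (d * c * approx_error z (Suc n))"
    have "c * upper_form g (w (Suc n)) = (a * d - b * c) * ?q + ?e"
      using c by (simp add: upper_form_def g_eq approx_error_def z w_def algebra_simps del: cf_convergent.simps)
    then have upper: "c * upper_form g (w (Suc n)) = ?q + ?e" by (simp add: det)
    have "?q \<noteq> 0"
      using convergent_step[OF irrational, of n] by (simp add: w_def del: cf_convergent.simps)
    moreover have "deg_le ?e (fdeg d + fdeg c - Q (Suc (Suc n)))"
      using c err by (cases "d = 0") (auto simp: deg_le_def fdeg_mult)
    moreover have "fdeg d + fdeg c - Q (Suc (Suc n)) < fdeg ?q"
      using that Qge[of n] Qge[of "Suc n"] by (simp add: Q_def)
    ultimately have "?q + ?e \<noteq> 0" "fdeg (?q + ?e) = fdeg ?q"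
      by (rule fdeg_add_dominant)+
    then have "c * upper_form g (w (Suc n)) \<noteq> 0" "fdeg (c * upper_form g (w (Suc n))) = Q (Suc n)"
      unfolding upper by (simp_all add: Q_def)
    then have "upper_form g (w (Suc n)) \<noteq> 0" "fdeg (c * upper_form g (w (Suc n))) = Q (Suc n)"
      by auto
    then show ?thesis using c by (simp add: left_end_def fdeg_mult)
  qed
  \<comment> \<open>The degree of the denominator grows at least linearly, and the bound also makes the left ends nonnegative.\<close>
  define n0 where "n0 = nat (\<bar>fdeg d\<bar> + \<bar>fdeg c\<bar>) + 2"
  have "w (Suc n) \<noteq> (0, 0) \<and> right_end g (w (Suc n)) = left_end g (w (Suc (Suc n)))
    \<and> left_end g (w (Suc (Suc n))) = left_end g (w (Suc n)) + int (degree (cf_digit z (Suc n)))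
    \<and> 0 \<le> left_end g (w (Suc n)) \<and> 1 \<le> degree (cf_digit z (Suc n))"
    if "\<bar>fdeg d\<bar> + \<bar>fdeg c\<bar> < int n" for n
  proof (intro conjI)
    show "w (Suc n) \<noteq> (0, 0)"
      using convergent_step[OF irrational, of n] by (auto simp: w_def simp del: cf_convergent.simps)
    show "right_end g (w (Suc n)) = left_end g (w (Suc (Suc n)))"
      using left[of "Suc n"] that by (simp add: right)
    show "left_end g (w (Suc (Suc n))) = left_end g (w (Suc n)) + int (degree (cf_digit z (Suc n)))"
      using left[of "Suc n"] left[of n] that degree_convergent_Suc_Suc[OF irrational, of n]
      by (simp add: Q_def w_def del: cf_convergent.simps)
    show "0 \<le> left_end g (w (Suc n))" using left[of n] that Qge[of n] by simp
    show "1 \<le> degree (cf_digit z (Suc n))" using convergent_step[OF irrational, of n] by simp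
  qed
  note tents = this
  show ?thesis
  proof (intro exI[of _ n0] allI impI)
    fix n assume "n0 \<le> n"
    then obtain n' where "n = Suc n'" "\<bar>fdeg d\<bar> + \<bar>fdeg c\<bar> < int n'"
      by (cases n) (auto simp: n0_def)
    then show "w n \<noteq> (0, 0) \<and> right_end g (w n) = left_end g (w (Suc n))
      \<and> left_end g (w (Suc n)) = left_end g (w n) + int (degree (cf_digit z n))
      \<and> 0 \<le> left_end g (w n) \<and> 1 \<le> degree (cf_digit z n)"
      using tents by blast
  qed
qed


text \<open>
  The list of return times is the list of zeros of the height, so each of its gaps is one tent.
\<close>

lemma (in tent_envelope) excursion_profile:
  assumes "k = kht x" "1 \<le> r"
  shows "0 < dgeo x s r" "tau x s (r + 1) = tau x s r + 2 * dgeo x s r"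
    and "j \<le> dgeo x s r \<Longrightarrow> kht x (tau x s r + j) = j"
    and "j \<le> dgeo x s r \<Longrightarrow> kht x (tau x s r + dgeo x s r + j) = dgeo x s r - j"
proof -
  have zeros: "return_times x = {N. k N = 0}"
    using zero_followed_by_one by (auto simp: return_times_def assms(1))
  obtain d where d: "0 < d" "tau x s (r + 1) = tau x s r + 2 * d"
    "\<And>j. j \<le> d \<Longrightarrow> k (tau x s r + j) = j" "\<And>j. j \<le> d \<Longrightarrow> k (tau x s r + d + j) = d - j"
  proof -
    have "s + (r + 1 - 1) = Suc (s + (r - 1))" using assms(2) by simp
    then show ?thesis
      using enumerate_zeros[of "s + (r - 1)"] that unfolding tau_def zeros by metis
  qed
  have "dgeo x s r = d"
    unfolding dgeo_def d(2) using Max_excursion[OF d(3,4)] by (simp add: assms(1))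
  then show "0 < dgeo x s r" "tau x s (r + 1) = tau x s r + 2 * dgeo x s r"
    "j \<le> dgeo x s r \<Longrightarrow> kht x (tau x s r + j) = j"
    "j \<le> dgeo x s r \<Longrightarrow> kht x (tau x s r + dgeo x s r + j) = dgeo x s r - j"
    using d by (simp_all add: assms(1))
qed

text \<open>
  The left ends of the tents of late convergents are return times, and no return time lies between
  two consecutive ones. The list \<open>T\<close> of these points starts with the second tent of the chain: that
  the left end of a tent is a zero is only known if another tent of the chain ends there.
\<close>

lemma return_times_eventually:
  fixes g :: "'k::field fls ^ 2 ^ 2"
  assumes g: "g \<in> SL2F" and "endpoint g \<notin> rational_pts"
  shows "\<exists>s m. \<forall>r\<ge>1. tau (Gamma_coset g) s (r + 1) =
    tau (Gamma_coset g) s r + 2 * degree (cf_digit (affine_coord (endpoint g)) (m + r))"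
proof -
  let ?x = "Gamma_coset g" and ?z = "affine_coord (endpoint g)"
  define w where "w = cf_convergent ?z"
  interpret tent_envelope "- {(0, 0)}" "left_end g" "right_end g" "kht ?x"
    by (rule tent_envelope_ray[OF assms])
  have zeros: "return_times ?x = {N. kht ?x N = 0}"
    using zero_followed_by_one by (auto simp: return_times_def)
  obtain m where m: "\<forall>n\<ge>m. w n \<noteq> (0, 0) \<and> right_end g (w n) = left_end g (w (Suc n))
    \<and> left_end g (w (Suc n)) = left_end g (w n) + int (degree (cf_digit ?z n))
    \<and> 0 \<le> left_end g (w n) \<and> 1 \<le> degree (cf_digit ?z n)"
    using convergents_are_tents[OF assms] unfolding w_def by blast
  define T where "T i = nat (2 * left_end g (w (m + Suc i)))" for i
  have T_Suc: "T (Suc i) = T i + 2 * degree (cf_digit ?z (m + Suc i))" for i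
    using m[rule_format, of "m + Suc i"] by (simp add: T_def nat_add_distrib nat_mult_distrib)
  have "T i \<in> {N. kht ?x N = 0}" for i
    using chain_zero[of "w (m + i)" "w (m + Suc i)"] m[rule_format, of "m + i"]
      m[rule_format, of "m + Suc i"] by (simp add: T_def)
  moreover have "T i < T (Suc i)" for i
    using m[rule_format, of "m + Suc i"] by (simp add: T_Suc)
  moreover have "N \<notin> {N. kht ?x N = 0}" if "T i < N" "N < T (Suc i)" for i N
  proof -
    have "0 < kht ?x N"
      using that m[rule_format, of "m + Suc i"] m[rule_format, of "m + Suc (Suc i)"]
      by (intro chain_positive[of "w (m + Suc i)"]) (auto simp: T_def)
    then show ?thesis by simp
  qed
  ultimately obtain s where s: "\<And>i. enumerate {N. kht ?x N = 0} (s + i) = T i"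
    using enumerate_tail[OF infinite_zeros, of T] by blast
  have "tau ?x s (r + 1) = tau ?x s r + 2 * degree (cf_digit ?z (m + r))" if "1 \<le> r" for r
    using T_Suc[of "r - 1"] s[of "r - 1"] s[of r] that by (simp add: tau_def zeros)
  then show ?thesis by blast
qed

theorem proposition5p3:
  fixes g :: "'k::{field, finite} fls ^ 2 ^ 2" and x :: "('k fls ^ 2 ^ 2) set"
  assumes "g \<in> SL2F" and "x = Gamma_coset g"
    and "endpoint g \<notin> rational_pts"
  shows "infinite (return_times x)
    \<and> (\<forall>s. \<forall>r\<ge>1. tau x s (r + 1) = tau x s r + 2 * dgeo x s r)
    \<and> (\<exists>s m. let B = tau x s;
                 d = (\<lambda>r. degree (cf_digit (affine_coord (endpoint g)) (m + r)))
        in \<forall>r\<ge>1.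
             dgeo x s r = d r
           \<and> B (r + 1) = B r + 2 * d r
           \<and> (\<forall>j<d r. \<forall>N. N = B r + j \<longrightarrow>
                 kht x N = j \<and> eps x N = Bwd \<and> Mpos x N = int (B r))
           \<and> (\<forall>j<d r. \<forall>N. N = B r + d r + j \<longrightarrow>
                 kht x N = d r - j \<and> eps x N = Fwd \<and> Mpos x N = int (B r + 2 * j))
           \<and> (\<forall>N. N = B (r + 1) \<longrightarrow>
                 kht x N = 0 \<and> eps x N = Bwd \<and> Mpos x N = int (B (r + 1))))"
proof -
  interpret tent_envelope "- {(0, 0)}" "left_end g" "right_end g" "kht x"
    unfolding assms(2) by (rule tent_envelope_ray[OF assms(1,3)])
  have zeros: "return_times x = {N. kht x N = 0}"
    using zero_followed_by_one by (auto simp: return_times_def)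
  note profile = excursion_profile[OF refl]
  have ascent: "kht x (tau x s r + j) = j \<and> eps x (tau x s r + j) = Bwd
      \<and> Mpos x (tau x s r + j) = int (tau x s r)"
    if "1 \<le> r" "j < dgeo x s r" for s r j
    using profile(3)[OF that(1), of j s] profile(3)[OF that(1), of "Suc j" s] that
    by (simp add: eps_def Mpos_def)
  have descent: "kht x (tau x s r + dgeo x s r + j) = dgeo x s r - j
      \<and> eps x (tau x s r + dgeo x s r + j) = Fwd
      \<and> Mpos x (tau x s r + dgeo x s r + j) = int (tau x s r + 2 * j)"
    if "1 \<le> r" "j < dgeo x s r" for s r j
    using profile(4)[OF that(1), of j s] profile(4)[OF that(1), of "Suc j" s] that
    by (simp add: eps_def Mpos_def Suc_diff_Suc)
  obtain s m where sm: "\<And>r. 1 \<le> r \<Longrightarrow>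
      tau x s (r + 1) = tau x s r + 2 * degree (cf_digit (affine_coord (endpoint g)) (m + r))"
    using return_times_eventually[OF assms(1,3)] unfolding assms(2) by blast
  have d: "degree (cf_digit (affine_coord (endpoint g)) (m + r)) = dgeo x s r" if "1 \<le> r" for r
    using sm[OF that] profile(2)[OF that, of s] by simp
  have "infinite (return_times x)" unfolding zeros by (rule infinite_zeros)
  moreover have "\<forall>s. \<forall>r\<ge>1. tau x s (r + 1) = tau x s r + 2 * dgeo x s r"
    using profile(2) by blast
  moreover have "\<exists>s m. let B = tau x s;
                 d = (\<lambda>r. degree (cf_digit (affine_coord (endpoint g)) (m + r)))
        in \<forall>r\<ge>1.
             dgeo x s r = d r
           \<and> B (r + 1) = B r + 2 * d r
           \<and> (\<forall>j<d r. \<forall>N. N = B r + j \<longrightarrow>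
                 kht x N = j \<and> eps x N = Bwd \<and> Mpos x N = int (B r))
           \<and> (\<forall>j<d r. \<forall>N. N = B r + d r + j \<longrightarrow>
                 kht x N = d r - j \<and> eps x N = Fwd \<and> Mpos x N = int (B r + 2 * j))
           \<and> (\<forall>N. N = B (r + 1) \<longrightarrow>
                 kht x N = 0 \<and> eps x N = Bwd \<and> Mpos x N = int (B (r + 1)))"
    unfolding Let_def
  proof (intro exI[of _ s] exI[of _ m] allI impI, unfold d, intro conjI allI impI)
    fix r :: nat assume r: "1 \<le> r"
    show "dgeo x s r = dgeo x s r" ..
    show "tau x s (r + 1) = tau x s r + 2 * dgeo x s r" using profile(2)[OF r] .
    show "kht x N = j" "eps x N = Bwd" "Mpos x N = int (tau x s r)"
      if "j < dgeo x s r" "N = tau x s r + j" for j N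
      using ascent[OF r that(1)] that(2) by auto
    show "kht x N = dgeo x s r - j" "eps x N = Fwd" "Mpos x N = int (tau x s r + 2 * j)"
      if "j < dgeo x s r" "N = tau x s r + dgeo x s r + j" for j N
      using descent[OF r that(1)] that(2) by auto
    show "kht x N = 0" "eps x N = Bwd" "Mpos x N = int (tau x s (r + 1))"
      if "N = tau x s (r + 1)" for N
      using ascent[of "r + 1" 0 s] profile(1)[of "r + 1" s] that by auto
  qed
  ultimately show ?thesis by blast
qed

end
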